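(* For any 3-tensor $t$ over $\mathbb{F}$ not of the form $x\otimes y\otimes z$, and any integers $\alpha\geq 0$, $\beta\geq 1$, $$\frac{\omega(\langle 2\rangle,t)\,\omega\bigl(t,\langle 2\rangle^{\otimes\alpha}\otimes\langle 2,2,2\rangle^{\otimes\beta}\bigr)-\alpha}{\beta}\;\geq\; 2\,\mathrm{irr}(t)+\frac{\alpha}{\beta}\bigl(\mathrm{irr}(t)-1\bigr)\;\geq\; 2\,\mathrm{irr}(t).$$
   Context: All tensors are 3-tensors over a fixed field $\mathbb{F}$, not of the form $x\otimes y\otimes z$. For $t \in \mathbb{F}^{n_1}\otimes\mathbb{F}^{n_2}\otimes\mathbb{F}^{n_3}$, $s\in \mathbb{F}^{m_1}\otimes\mathbb{F}^{m_2}\otimes\mathbb{F}^{m_3}$ write $t\geq s$ if there are linear maps $A_i:\mathbb{F}^{n_i}\to\mathbb{F}^{m_i}$ with $(A_1\otimes A_2\otimes A_3)t=s$. Tensor (Kronecker) products and powers are regarded as 3-tensors by grouping factors. The relative exponent is $\omega(t,s):=\lim_{n\to\infty}\frac1n\min\{m\in\mathbb{N}: t^{\otimes m}\geq s^{\otimes n}\}$. $\langle n\rangle:=\sum_{i=1}^n e_i\otimes e_i\otimes e_i$. The irreversibility is $\mathrm{irr}(t):=\omega(\langle2\rangle,t)\,\omega(t,\langle2\rangle)$. The matrix multiplication tensor is $\langle a,b,c\rangle:=\sum_{i=1}^a\sum_{j=1}^b\sum_{k=1}^c e_{(i,j)}\otimes e_{(j,k)}\otimes e_{(k,i)}$. 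*)

theory Defs
  imports
    "Jordan_Normal_Form.Matrix"
    "HOL-Library.Extended_Real"
begin

text \<open>
  A 3-tensor carries its format \<open>(n1, n2, n3)\<close> together with its coordinates in the standard basis
  of \<open>F^n1 \<otimes> F^n2 \<otimes> F^n3\<close>, indexed from \<open>0\<close>. Coordinates outside the format are \<open>0\<close>, so that
  equality of values of this type is equality of formats and of tensors.
\<close>

typedef (overloaded) 'a tensor3 =
  "{(n1, n2, n3, f :: nat \<Rightarrow> nat \<Rightarrow> nat \<Rightarrow> 'a :: zero).
      \<forall>i j k. \<not> (i < n1 \<and> j < n2 \<and> k < n3) \<longrightarrow> f i j k = 0}"
  by (rule exI[of _ "(0, 0, 0, \<lambda>_ _ _. 0)"]) simp

setup_lifting type_definition_tensor3

lift_definition tensor3 ::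
  "nat \<Rightarrow> nat \<Rightarrow> nat \<Rightarrow> (nat \<Rightarrow> nat \<Rightarrow> nat \<Rightarrow> 'a) \<Rightarrow> 'a :: zero tensor3"
  is "\<lambda>n1 n2 n3 f. (n1, n2, n3, \<lambda>i j k. if i < n1 \<and> j < n2 \<and> k < n3 then f i j k else 0)"
  by auto

lift_definition dim1 :: "'a :: zero tensor3 \<Rightarrow> nat" is "\<lambda>(n1, n2, n3, f). n1" .
lift_definition dim2 :: "'a :: zero tensor3 \<Rightarrow> nat" is "\<lambda>(n1, n2, n3, f). n2" .
lift_definition dim3 :: "'a :: zero tensor3 \<Rightarrow> nat" is "\<lambda>(n1, n2, n3, f). n3" .

lift_definition coord :: "'a :: zero tensor3 \<Rightarrow> nat \<Rightarrow> nat \<Rightarrow> nat \<Rightarrow> 'a"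
  is "\<lambda>(n1, n2, n3, f). f" .

lemma dim_tensor3 [simp]:
  "dim1 (tensor3 n1 n2 n3 f) = n1"
  "dim2 (tensor3 n1 n2 n3 f) = n2"
  "dim3 (tensor3 n1 n2 n3 f) = n3"
  by (transfer, simp)+

lemma coord_tensor3:
  "coord (tensor3 n1 n2 n3 f) i j k = (if i < n1 \<and> j < n2 \<and> k < n3 then f i j k else 0)"
  by transfer simp

lemma coord_outside:
  "\<not> (i < dim1 t \<and> j < dim2 t \<and> k < dim3 t) \<Longrightarrow> coord t i j k = 0"
  by transfer auto

lemma tensor3_eqI:
  assumes "dim1 s = dim1 t" "dim2 s = dim2 t" "dim3 s = dim3 t"
    and "\<And>i j k. i < dim1 t \<Longrightarrow> j < dim2 t \<Longrightarrow> k < dim3 t \<Longrightarrow> coord s i j k = coord t i j k"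
  shows "s = t"
proof -
  have "coord s i j k = coord t i j k" for i j k
    using assms coord_outside[of i s j k] coord_outside[of i t j k] by metis
  then have "coord s = coord t" by blast
  with assms(1-3) show ?thesis by transfer auto
qed

definition outer3 :: "'a :: field vec \<Rightarrow> 'a vec \<Rightarrow> 'a vec \<Rightarrow> 'a tensor3" where
  "outer3 x y z =
     tensor3 (dim_vec x) (dim_vec y) (dim_vec z) (\<lambda>i j k. x $ i * y $ j * z $ k)"

text \<open>The zero tensor counts as simple, since the factors may vanish.\<close>

definition simple_tensor :: "'a :: field tensor3 \<Rightarrow> bool" where
  "simple_tensor t \<longleftrightarrow> (\<exists>x y z. t = outer3 x y z)"

text \<open>\<open>(A \<otimes> B \<otimes> C) t\<close>, meaningful if the column dimensions match the format of \<open>t\<close>.\<close>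

definition apply3 :: "'a :: field mat \<Rightarrow> 'a mat \<Rightarrow> 'a mat \<Rightarrow> 'a tensor3 \<Rightarrow> 'a tensor3" where
  "apply3 A B C t =
     tensor3 (dim_row A) (dim_row B) (dim_row C)
       (\<lambda>a b c. \<Sum>i<dim1 t. \<Sum>j<dim2 t. \<Sum>k<dim3 t.
          A $$ (a, i) * B $$ (b, j) * C $$ (c, k) * coord t i j k)"

definition restricts :: "'a :: field tensor3 \<Rightarrow> 'a tensor3 \<Rightarrow> bool" where
  "restricts t s \<longleftrightarrow>
     (\<exists>A \<in> carrier_mat (dim1 s) (dim1 t).
      \<exists>B \<in> carrier_mat (dim2 s) (dim2 t).
      \<exists>C \<in> carrier_mat (dim3 s) (dim3 t). apply3 A B C t = s)"

text \<open>
  In the Kronecker product, \<open>F^n \<otimes> F^m\<close> is identified with \<open>F^(n * m)\<close> by letting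
  \<open>e_i \<otimes> e_i'\<close> correspond to \<open>e_(i * m + i')\<close>.
\<close>

definition kron3 :: "'a :: field tensor3 \<Rightarrow> 'a tensor3 \<Rightarrow> 'a tensor3" where
  "kron3 t s =
     tensor3 (dim1 t * dim1 s) (dim2 t * dim2 s) (dim3 t * dim3 s)
       (\<lambda>i j k. coord t (i div dim1 s) (j div dim2 s) (k div dim3 s) *
                coord s (i mod dim1 s) (j mod dim2 s) (k mod dim3 s))"

definition unit_tensor :: "nat \<Rightarrow> 'a :: field tensor3" where
  "unit_tensor n = tensor3 n n n (\<lambda>i j k. if i = j \<and> j = k then 1 else 0)"

primrec kron_power :: "'a :: field tensor3 \<Rightarrow> nat \<Rightarrow> 'a tensor3" where
  "kron_power t 0 = unit_tensor 1"
| "kron_power t (Suc n) = kron3 t (kron_power t n)"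

text \<open>The basis vectors \<open>e_(i,j)\<close>, \<open>e_(j,k)\<close>, \<open>e_(k,i)\<close> are numbered row by row.\<close>

definition matmul_tensor :: "nat \<Rightarrow> nat \<Rightarrow> nat \<Rightarrow> 'a :: field tensor3" where
  "matmul_tensor a b c =
     tensor3 (a * b) (b * c) (c * a)
       (\<lambda>p q r. \<Sum>i<a. \<Sum>j<b. \<Sum>k<c.
          if p = i * b + j \<and> q = j * c + k \<and> r = k * a + i then 1 else 0)"

text \<open>
  The infimum in \<^typ>\<open>enat\<close> is the minimum if the set is nonempty and \<open>\<infinity>\<close> otherwise. The latter
  does occur: if a flattening of \<open>t\<close> has rank one, no power of \<open>t\<close> restricts to \<open>unit_tensor 2\<close>.
\<close>

definition rel_exponent :: "'a :: field tensor3 \<Rightarrow> 'a tensor3 \<Rightarrow> ereal" where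
  "rel_exponent t s =
     lim (\<lambda>n. ereal_of_enat (Inf {enat m |m. restricts (kron_power t m) (kron_power s n)})
                / ereal (real n))"

definition irreversibility :: "'a :: field tensor3 \<Rightarrow> ereal" where
  "irreversibility t = rel_exponent (unit_tensor 2) t * rel_exponent t (unit_tensor 2)"

end

theory Submission
  imports Defs "Jordan_Normal_Form.Determinant"
begin

text \<open>
  Relative exponents satisfy the triangle inequality
  \<open>\<omega>(t, u) \<le> \<omega>(t, s) \<omega>(s, u)\<close>. Apply it to \<open>s = \<langle>2\<rangle>^\<alpha> \<otimes> \<langle>2,2,2\<rangle>^\<beta>\<close> and \<open>u = \<langle>2\<rangle>\<close>: since
  powers of \<open>s\<close> restrict asymptotically to unit tensors at the maximal rate \<open>\<alpha> + 2 \<beta>\<close>, this gives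
  \<open>(\<alpha> + 2 \<beta>) \<omega>(t, \<langle>2\<rangle>) \<le> \<omega>(t, s)\<close>, and multiplication by \<open>\<omega>(\<langle>2\<rangle>, t)\<close> yields the first inequality.
  The rate comes from Strassen's monomial degeneration of \<open>\<langle>n,n,n\<rangle>\<close> to a unit tensor of size
  proportional to \<open>n^2\<close>. On a large power, pigeonholing on the degrees keeps all but a polynomial factor
  of the diagonal and turns the degeneration into a restriction that only sets variables to zero; no
  interpolation is needed, so the field may be finite. The second inequality is \<open>irr(t) \<ge> 1\<close>, which
  is the triangle inequality again, together with \<open>0 < \<omega>(\<langle>2\<rangle>, t) < \<infinity>\<close>; the lower bound holds because
  some flattening of a non-simple \<open>t\<close> has rank at least 2.
\<close>

section \<open>Restriction and Kronecker products\<close>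

text \<open>Coefficient functions replace matrices, so that witnesses can be written down without
  dimension conditions.\<close>

lemma restricts_iff:
  "restricts t s \<longleftrightarrow>
     (\<exists>A B C. \<forall>a<dim1 s. \<forall>b<dim2 s. \<forall>c<dim3 s. coord s a b c =
        (\<Sum>i<dim1 t. \<Sum>j<dim2 t. \<Sum>k<dim3 t. A a i * B b j * C c k * coord t i j k))"
  (is "_ \<longleftrightarrow> ?R")
proof
  assume "restricts t s"
  then obtain A B C where dims: "A \<in> carrier_mat (dim1 s) (dim1 t)" "B \<in> carrier_mat (dim2 s) (dim2 t)"
      "C \<in> carrier_mat (dim3 s) (dim3 t)" and s: "apply3 A B C t = s"
    unfolding restricts_def by blast
  have "coord (apply3 A B C t) a b c = (\<Sum>i<dim1 t. \<Sum>j<dim2 t. \<Sum>k<dim3 t.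
      A $$ (a, i) * B $$ (b, j) * C $$ (c, k) * coord t i j k)"
    if "a < dim1 s" "b < dim2 s" "c < dim3 s" for a b c
    using dims that by (auto simp: apply3_def coord_tensor3)
  then show ?R
    unfolding s by (intro exI[of _ "\<lambda>i j. A $$ (i, j)"] exI[of _ "\<lambda>i j. B $$ (i, j)"]
        exI[of _ "\<lambda>i j. C $$ (i, j)"]) blast
next
  assume ?R
  then obtain A B C where eq: "\<And>a b c. a < dim1 s \<Longrightarrow> b < dim2 s \<Longrightarrow> c < dim3 s \<Longrightarrow>
      coord s a b c = (\<Sum>i<dim1 t. \<Sum>j<dim2 t. \<Sum>k<dim3 t. A a i * B b j * C c k * coord t i j k)"
    by blast
  let ?M = "\<lambda>n m A. mat n m (\<lambda>(a, i). A a i)"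
  have "apply3 (?M (dim1 s) (dim1 t) A) (?M (dim2 s) (dim2 t) B) (?M (dim3 s) (dim3 t) C) t = s"
    by (rule tensor3_eqI) (simp_all add: apply3_def coord_tensor3 eq)
  then show "restricts t s"
    unfolding restricts_def by (meson mat_carrier)
qed

lemma restricts_trans:
  assumes "restricts t s" "restricts s u"
  shows "restricts t u"
proof -
  obtain A B C where 1: "\<And>a b c. a < dim1 s \<Longrightarrow> b < dim2 s \<Longrightarrow> c < dim3 s \<Longrightarrow>
      coord s a b c = (\<Sum>i<dim1 t. \<Sum>j<dim2 t. \<Sum>k<dim3 t. A a i * B b j * C c k * coord t i j k)"
    using assms(1) unfolding restricts_iff by blast
  obtain A' B' C' where 2: "\<And>a b c. a < dim1 u \<Longrightarrow> b < dim2 u \<Longrightarrow> c < dim3 u \<Longrightarrow>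
      coord u a b c = (\<Sum>i<dim1 s. \<Sum>j<dim2 s. \<Sum>k<dim3 s. A' a i * B' b j * C' c k * coord s i j k)"
    using assms(2) unfolding restricts_iff by blast
  have "coord u a b c = (\<Sum>i<dim1 t. \<Sum>j<dim2 t. \<Sum>k<dim3 t.
      (\<Sum>i'<dim1 s. A' a i' * A i' i) * (\<Sum>j'<dim2 s. B' b j' * B j' j) *
      (\<Sum>k'<dim3 s. C' c k' * C k' k) * coord t i j k)"
    if "a < dim1 u" "b < dim2 u" "c < dim3 u" for a b c
  proof -
    \<comment> \<open>Each triple sum becomes one sum over a product set, so a single exchange moves
      all six summations.\<close>
    let ?S = "{..<dim1 s} \<times> {..<dim2 s} \<times> {..<dim3 s}"
    let ?T = "{..<dim1 t} \<times> {..<dim2 t} \<times> {..<dim3 t}"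
    let ?f = "\<lambda>(i', j', k') (i, j, k).
      A' a i' * B' b j' * C' c k' * (A i' i * B j' j * C k' k * coord t i j k)"
    have "coord u a b c = (\<Sum>i'<dim1 s. \<Sum>j'<dim2 s. \<Sum>k'<dim3 s. A' a i' * B' b j' * C' c k' *
        (\<Sum>i<dim1 t. \<Sum>j<dim2 t. \<Sum>k<dim3 t. A i' i * B j' j * C k' k * coord t i j k))"
      using 2[OF that] by (simp add: 1)
    also have "\<dots> = (\<Sum>x\<in>?S. \<Sum>y\<in>?T. ?f x y)"
      by (simp only: sum_distrib_left sum.cartesian_product' prod.case)
    also have "\<dots> = (\<Sum>y\<in>?T. \<Sum>x\<in>?S. ?f x y)"
      by (rule sum.swap)
    also have "\<dots> = (\<Sum>i<dim1 t. \<Sum>j<dim2 t. \<Sum>k<dim3 t.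
        \<Sum>i'<dim1 s. \<Sum>j'<dim2 s. \<Sum>k'<dim3 s. ?f (i', j', k') (i, j, k))"
      by (simp only: sum.cartesian_product' prod.case)
    also have "\<dots> = (\<Sum>i<dim1 t. \<Sum>j<dim2 t. \<Sum>k<dim3 t.
      (\<Sum>i'<dim1 s. A' a i' * A i' i) * (\<Sum>j'<dim2 s. B' b j' * B j' j) *
      (\<Sum>k'<dim3 s. C' c k' * C k' k) * coord t i j k)"
      by (simp only: mult.assoc sum_distrib_right, simp only: sum_distrib_left prod.case mult_ac)
    finally show ?thesis .
  qed
  then show ?thesis
    unfolding restricts_iff
    by (intro exI[of _ "\<lambda>a i. \<Sum>i'<dim1 s. A' a i' * A i' i"]
        exI[of _ "\<lambda>a i. \<Sum>i'<dim2 s. B' a i' * B i' i"]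
        exI[of _ "\<lambda>a i. \<Sum>i'<dim3 s. C' a i' * C i' i"]) blast
qed

lemma sum3_delta:
  fixes f :: "nat \<Rightarrow> nat \<Rightarrow> nat \<Rightarrow> 'b :: comm_ring_1"
  shows "(\<Sum>i<m. \<Sum>j<n. \<Sum>k<p. (if i = x then 1 else 0) * (if j = y then 1 else 0) *
      (if k = z then 1 else 0) * f i j k) = (if x < m \<and> y < n \<and> z < p then f x y z else 0)"
proof -
  have k: "(\<Sum>k<p. (if i = x then 1 else 0) * (if j = y then 1 else 0) * (if k = z then 1 else 0) * f i j k) =
      (if i = x \<and> j = y \<and> z < p then f x y z else 0)" for i j
    by (cases "i = x"; cases "j = y") (simp_all add: if_distrib[of "\<lambda>x. x * _"] cong: if_cong)
  have j: "(\<Sum>j<n. if i = x \<and> j = y \<and> z < p then f x y z else 0) =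
      (if i = x \<and> y < n \<and> z < p then f x y z else 0)" for i
    by (cases "i = x \<and> z < p") auto
  show ?thesis
    unfolding k j by (cases "y < n \<and> z < p") auto
qed

text \<open>The matrices are 0/1 selections of coordinates. This covers relabelling of basis vectors
  as well as setting variables to zero.\<close>

lemma restricts_select:
  assumes "\<And>i. i < dim1 s \<Longrightarrow> a i < dim1 t" "\<And>i. i < dim2 s \<Longrightarrow> b i < dim2 t"
    "\<And>i. i < dim3 s \<Longrightarrow> c i < dim3 t"
    and "\<And>i j k. i < dim1 s \<Longrightarrow> j < dim2 s \<Longrightarrow> k < dim3 s \<Longrightarrow>
      coord s i j k = coord t (a i) (b j) (c k)"
  shows "restricts t s"
proof -
  let ?D = "\<lambda>f x i. if i = f x then 1 else (0 :: 'a)"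
  have "coord s x y z = (\<Sum>i<dim1 t. \<Sum>j<dim2 t. \<Sum>k<dim3 t.
      ?D a x i * ?D b y j * ?D c z k * coord t i j k)"
    if "x < dim1 s" "y < dim2 s" "z < dim3 s" for x y z
    using that assms by (simp only: sum3_delta) simp
  then show ?thesis
    unfolding restricts_iff by (intro exI[of _ "?D a"] exI[of _ "?D b"] exI[of _ "?D c"]) simp
qed

lemma restricts_refl: "restricts t t"
  by (rule restricts_select[of _ id _ id id]) auto

section \<open>Kronecker products in coordinates\<close>

lemma dim_kron3 [simp]:
  "dim1 (kron3 t s) = dim1 t * dim1 s"
  "dim2 (kron3 t s) = dim2 t * dim2 s"
  "dim3 (kron3 t s) = dim3 t * dim3 s"
  by (simp_all add: kron3_def)

lemma less_mult_div_mod: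
  fixes i m n :: nat
  assumes "i < m * n"
  shows "i div n < m" "i mod n < n"
  using assms by (simp add: less_mult_imp_div_less)
    (metis assms mod_less_divisor mult_0_right neq0_conv not_less0)

lemma mult_add_less_mult:
  fixes i j m n :: nat
  assumes "i < m" "j < n"
  shows "i * n + j < m * n"
proof -
  have "i * n + j < Suc i * n" using assms by simp
  also have "\<dots> \<le> m * n" using assms by (intro mult_right_mono) auto
  finally show ?thesis .
qed

text \<open>An index outside the product format has its quotient or its remainder outside the format
  of a factor, so the formula holds without range conditions.\<close>

lemma coord_kron3:
  "coord (kron3 t s) i j k = coord t (i div dim1 s) (j div dim2 s) (k div dim3 s) *
     coord s (i mod dim1 s) (j mod dim2 s) (k mod dim3 s)"
proof (cases "i < dim1 t * dim1 s \<and> j < dim2 t * dim2 s \<and> k < dim3 t * dim3 s")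
  case True
  then show ?thesis by (simp add: kron3_def coord_tensor3)
next
  case False
  have "coord t (i div dim1 s) (j div dim2 s) (k div dim3 s) = 0 \<or>
      coord s (i mod dim1 s) (j mod dim2 s) (k mod dim3 s) = 0"
  proof (rule ccontr)
    assume "\<not> ?thesis"
    then have *: "i div dim1 s < dim1 t" "j div dim2 s < dim2 t" "k div dim3 s < dim3 t"
      "i mod dim1 s < dim1 s" "j mod dim2 s < dim2 s" "k mod dim3 s < dim3 s"
      by (metis coord_outside)+
    then have "i < dim1 t * dim1 s" "j < dim2 t * dim2 s" "k < dim3 t * dim3 s"
      using mult_add_less_mult by (metis div_mult_mod_eq)+
    with False show False by blast
  qed
  with False show ?thesis by (auto simp: kron3_def coord_tensor3)
qed

lemma coord_kron3_pair:
  assumes "i' < dim1 s" "j' < dim2 s" "k' < dim3 s"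
  shows "coord (kron3 t s) (i * dim1 s + i') (j * dim2 s + j') (k * dim3 s + k') =
    coord t i j k * coord s i' j' k'"
  using assms by (simp add: coord_kron3)

lemma sum_div_mod:
  fixes f :: "nat \<Rightarrow> nat \<Rightarrow> 'b :: comm_monoid_add"
  shows "(\<Sum>i<m * n. f (i div n) (i mod n)) = (\<Sum>i<m. \<Sum>j<n. f i j)"
proof -
  have "(\<Sum>i<m. \<Sum>j<n. f i j) = (\<Sum>(i, j)\<in>{..<m} \<times> {..<n}. f i j)"
    by (simp add: sum.cartesian_product)
  also have "\<dots> = (\<Sum>i<m * n. f (i div n) (i mod n))"
    by (rule sum.reindex_bij_witness[of _ "\<lambda>i. (i div n, i mod n)" "\<lambda>(i, j). i * n + j"])
      (auto simp: less_mult_div_mod mult_add_less_mult)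
  finally show ?thesis by simp
qed

lemma sum3_div_mod:
  fixes f :: "nat \<Rightarrow> nat \<Rightarrow> nat \<Rightarrow> nat \<Rightarrow> nat \<Rightarrow> nat \<Rightarrow> 'b :: comm_monoid_add"
  shows "(\<Sum>i<m * n. \<Sum>j<m' * n'. \<Sum>k<m'' * n''.
      f (i div n) (i mod n) (j div n') (j mod n') (k div n'') (k mod n'')) =
    (\<Sum>i<m. \<Sum>i'<n. \<Sum>j<m'. \<Sum>j'<n'. \<Sum>k<m''. \<Sum>k'<n''. f i i' j j' k k')"
proof -
  have "(\<Sum>k<m'' * n''. f i i' j j' (k div n'') (k mod n'')) = (\<Sum>k<m''. \<Sum>k'<n''. f i i' j j' k k')"
    for i i' j j' by (rule sum_div_mod)
  moreover from this have "(\<Sum>j<m' * n'. \<Sum>k<m'' * n''. f i i' (j div n') (j mod n') (k div n'') (k mod n'')) =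
      (\<Sum>j<m'. \<Sum>j'<n'. \<Sum>k<m''. \<Sum>k'<n''. f i i' j j' k k')" for i i'
    using sum_div_mod[where f = "\<lambda>j j'. \<Sum>k<m''. \<Sum>k'<n''. f i i' j j' k k'" and m = m' and n = n']
    by simp
  ultimately show ?thesis
    using sum_div_mod[where f = "\<lambda>i i'. \<Sum>j<m'. \<Sum>j'<n'. \<Sum>k<m''. \<Sum>k'<n''. f i i' j j' k k'"
        and m = m and n = n] by simp
qed

lemma kron3_mono:
  assumes "restricts t s" "restricts t' s'"
  shows "restricts (kron3 t t') (kron3 s s')"
proof -
  obtain A B C where 1: "\<And>a b c. a < dim1 s \<Longrightarrow> b < dim2 s \<Longrightarrow> c < dim3 s \<Longrightarrow>
      coord s a b c = (\<Sum>i<dim1 t. \<Sum>j<dim2 t. \<Sum>k<dim3 t. A a i * B b j * C c k * coord t i j k)"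
    using assms(1) unfolding restricts_iff by blast
  obtain A' B' C' where 2: "\<And>a b c. a < dim1 s' \<Longrightarrow> b < dim2 s' \<Longrightarrow> c < dim3 s' \<Longrightarrow>
      coord s' a b c = (\<Sum>i<dim1 t'. \<Sum>j<dim2 t'. \<Sum>k<dim3 t'. A' a i * B' b j * C' c k * coord t' i j k)"
    using assms(2) unfolding restricts_iff by blast
  \<comment> \<open>These are the entries of the Kronecker product of two matrices.\<close>
  let ?K = "\<lambda>d d' A A' a i. A (a div d) (i div d') * A' (a mod d) (i mod d') :: 'a"
  have main: "coord (kron3 s s') a b c =
      (\<Sum>i<dim1 t * dim1 t'. \<Sum>j<dim2 t * dim2 t'. \<Sum>k<dim3 t * dim3 t'.
        ?K (dim1 s') (dim1 t') A A' a i * ?K (dim2 s') (dim2 t') B B' b j *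
        ?K (dim3 s') (dim3 t') C C' c k * coord (kron3 t t') i j k)"
    if "a < dim1 s * dim1 s'" "b < dim2 s * dim2 s'" "c < dim3 s * dim3 s'" for a b c
  proof -
    note ab = less_mult_div_mod[OF that(1)] less_mult_div_mod[OF that(2)] less_mult_div_mod[OF that(3)]
    let ?a = "a div dim1 s'" and ?b = "b div dim2 s'" and ?c = "c div dim3 s'"
    let ?a' = "a mod dim1 s'" and ?b' = "b mod dim2 s'" and ?c' = "c mod dim3 s'"
    have "coord (kron3 s s') a b c =
      (\<Sum>i<dim1 t. \<Sum>j<dim2 t. \<Sum>k<dim3 t. A ?a i * B ?b j * C ?c k * coord t i j k) *
      (\<Sum>i<dim1 t'. \<Sum>j<dim2 t'. \<Sum>k<dim3 t'. A' ?a' i * B' ?b' j * C' ?c' k * coord t' i j k)"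
      using ab by (simp add: coord_kron3 1 2)
    also have "\<dots> = (\<Sum>i<dim1 t. \<Sum>i'<dim1 t'. \<Sum>j<dim2 t. \<Sum>j'<dim2 t'. \<Sum>k<dim3 t. \<Sum>k'<dim3 t'.
       (A ?a i * B ?b j * C ?c k * coord t i j k) * (A' ?a' i' * B' ?b' j' * C' ?c' k' * coord t' i' j' k'))"
      by (simp only: sum_product)
    also have "\<dots> = (\<Sum>i<dim1 t. \<Sum>i'<dim1 t'. \<Sum>j<dim2 t. \<Sum>j'<dim2 t'. \<Sum>k<dim3 t. \<Sum>k'<dim3 t'.
       (A ?a i * A' ?a' i') * (B ?b j * B' ?b' j') * (C ?c k * C' ?c' k') * (coord t i j k * coord t' i' j' k'))"
      by (simp only: mult_ac)
    finally show ?thesis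
      unfolding coord_kron3
      using sum3_div_mod[where f = "\<lambda>i i' j j' k k'. (A ?a i * A' ?a' i') * (B ?b j * B' ?b' j') *
        (C ?c k * C' ?c' k') * (coord t i j k * coord t' i' j' k')" and m = "dim1 t" and n = "dim1 t'"
        and m' = "dim2 t" and n' = "dim2 t'" and m'' = "dim3 t" and n'' = "dim3 t'"] by simp
  qed
  show ?thesis
    unfolding restricts_iff dim_kron3
    by (intro exI[of _ "?K (dim1 s') (dim1 t') A A'"] exI[of _ "?K (dim2 s') (dim2 t') B B'"]
        exI[of _ "?K (dim3 s') (dim3 t') C C'"] allI impI) (rule main)
qed

text \<open>Numbering pairs row by row is associative, so this is an equality and not only an
  isomorphism; the power laws below inherit this.\<close>

lemma kron3_assoc: "kron3 (kron3 t s) u = kron3 t (kron3 s u)"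
proof (rule tensor3_eqI)
  fix i j k
  have mod_mod: "i mod (m * n) mod n = i mod n" for i m n :: nat
    by (simp add: mod_mult2_eq' mult.commute[of m n] mod_mult2_eq)
  have mod_div: "i mod (m * n) div n = i div n mod m" for i m n :: nat
    by (cases "n = 0") (simp_all add: mult.commute[of m n] mod_mult2_eq)
  have div_div: "i div (m * n) = i div n div m" for i m n :: nat
    by (simp add: mult.commute[of m n] div_mult2_eq)
  show "coord (kron3 (kron3 t s) u) i j k = coord (kron3 t (kron3 s u)) i j k"
    by (simp add: coord_kron3 mod_mod mod_div div_div mult_ac)
qed (simp_all add: mult_ac)

section \<open>Unit tensors and Kronecker powers\<close>

lemma dim_unit_tensor [simp]:
  "dim1 (unit_tensor n) = n" "dim2 (unit_tensor n) = n" "dim3 (unit_tensor n) = n"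
  by (simp_all add: unit_tensor_def)

lemma coord_unit_tensor:
  "coord (unit_tensor n) i j k = (if i < n \<and> i = j \<and> j = k then 1 else 0)"
  by (auto simp: unit_tensor_def coord_tensor3)

lemma kron3_unit_left [simp]: "kron3 (unit_tensor (Suc 0)) t = t"
  by (rule tensor3_eqI) (simp_all add: coord_kron3 coord_unit_tensor)

lemma kron3_unit_right [simp]: "kron3 t (unit_tensor (Suc 0)) = t"
  by (rule tensor3_eqI) (simp_all add: coord_kron3 coord_unit_tensor)

lemma kron3_unit_unit: "kron3 (unit_tensor m) (unit_tensor n) = unit_tensor (m * n)"
proof (rule tensor3_eqI)
  fix i j k :: nat
  have eq: "i = j \<longleftrightarrow> i div n = j div n \<and> i mod n = j mod n" for i j :: nat
    by (metis div_mult_mod_eq)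
  assume "i < dim1 (unit_tensor (m * n) :: 'a tensor3)"
  then have "i < m * n" by simp
  then show "coord (kron3 (unit_tensor m) (unit_tensor n)) i j k = coord (unit_tensor (m * n)) i j k"
    using less_mult_div_mod[of i m n] eq[of i j] eq[of j k] by (simp add: coord_kron3 coord_unit_tensor)
qed simp_all

lemma kron_power_1 [simp]: "kron_power t (Suc 0) = t"
  by simp

lemma kron_power_add: "kron_power t (m + n) = kron3 (kron_power t m) (kron_power t n)"
  by (induction m) (simp_all add: kron3_assoc)

lemma kron_power_mult: "kron_power t (m * n) = kron_power (kron_power t m) n"
  by (induction n) (simp_all add: kron_power_add)

lemma kron_power_unit: "kron_power (unit_tensor m) n = unit_tensor (m ^ n)"
  by (induction n) (simp_all add: kron3_unit_unit)

lemma kron_power_mono: "restricts t s \<Longrightarrow> restricts (kron_power t n) (kron_power s n)"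
  by (induction n) (simp_all add: restricts_refl kron3_mono)

lemma restricts_unit_mono: "m \<le> n \<Longrightarrow> restricts (unit_tensor n) (unit_tensor m)"
  by (rule restricts_select[of _ id _ id id]) (auto simp: coord_unit_tensor)

lemma sum_div_mod_div_mod:
  fixes f :: "nat \<Rightarrow> nat \<Rightarrow> nat \<Rightarrow> 'b :: comm_monoid_add"
  shows "(\<Sum>l<d * m * n. f (l div n div m) (l div n mod m) (l mod n)) = (\<Sum>i<d. \<Sum>j<m. \<Sum>k<n. f i j k)"
  using sum_div_mod[where f = "\<lambda>x k. f (x div m) (x mod m) k" and m = "d * m" and n = n]
    sum_div_mod[where f = "\<lambda>i j. \<Sum>k<n. f i j k" and m = d and n = m] by simp

text \<open>Every entry of \<open>t\<close> contributes one simple tensor, a multiple of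
  \<open>e_i \<otimes> e_j \<otimes> e_k\<close>. The index \<open>l\<close> of the unit tensor
  encodes \<open>(i, j, k)\<close>, and the third matrix absorbs the scalar.\<close>

lemma unit_restricts:
  "restricts (unit_tensor (dim1 t * dim2 t * dim3 t)) t"
proof -
  let ?m = "dim2 t" and ?n = "dim3 t"
  let ?N = "dim1 t * ?m * ?n"
  let ?A = "\<lambda>a l. (if l div ?n div ?m = a then 1 else 0)"
  let ?B = "\<lambda>b l. (if l div ?n mod ?m = b then 1 else 0)"
  let ?C = "\<lambda>c l. (if l mod ?n = c then 1 else 0) *
    coord t (l div ?n div ?m) (l div ?n mod ?m) (l mod ?n)"
  have main: "coord t a b c = (\<Sum>i<?N. \<Sum>j<?N. \<Sum>k<?N.
      ?A a i * ?B b j * ?C c k * coord (unit_tensor ?N) i j k)"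
    if "a < dim1 t" "b < dim2 t" "c < dim3 t" for a b c
  proof -
    have "x i * y j * z k * coord (unit_tensor n) i j k =
        (if j = i then if k = i then x i * y i * z i else 0 else 0)"
      if "i < n" for n i j k and x y z :: "nat \<Rightarrow> 'a"
      using that by (simp add: coord_unit_tensor)
    then have delta: "(\<Sum>k<n. x i * y j * z k * coord (unit_tensor n) i j k) =
        (if j = i then x i * y i * z i else 0)"
      if "i < n" for n i j and x y z :: "nat \<Rightarrow> 'a"
      using that by simp
    have "(\<Sum>i<?N. \<Sum>j<?N. \<Sum>k<?N. ?A a i * ?B b j * ?C c k * coord (unit_tensor ?N) i j k) =
      (\<Sum>i<?N. \<Sum>j<?N. if j = i then ?A a i * ?B b i * ?C c i else 0)"
      by (intro sum.cong refl, rule delta[of _ ?N "?A a" "?B b" _ "?C c"]) simp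
    also have "\<dots> = (\<Sum>l<?N. ?A a l * ?B b l * ?C c l)"
      by simp
    also have "\<dots> = (\<Sum>i<dim1 t. \<Sum>j<?m. \<Sum>k<?n.
        (if i = a then 1 else 0) * (if j = b then 1 else 0) * ((if k = c then 1 else 0) * coord t i j k))"
      by (rule sum_div_mod_div_mod[where f = "\<lambda>i j k. (if i = a then 1 else 0) *
          (if j = b then 1 else 0) * ((if k = c then 1 else 0) * coord t i j k)"])
    also have "\<dots> = coord t a b c"
      using that by (simp only: mult.assoc[symmetric] sum3_delta) simp
    finally show ?thesis by simp
  qed
  show ?thesis
    unfolding restricts_iff dim_unit_tensor
    by (intro exI[of _ ?A] exI[of _ ?B] exI[of _ ?C] allI impI) (rule main)
qed

section \<open>The relative exponent as a limit and as a lower bound\<close>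

text \<open>Fekete's lemma: the limit is the infimum of the quotients, which yields a bound at every
  single \<open>n\<close> along with convergence.\<close>

lemma subadditive_limit:
  fixes f :: "nat \<Rightarrow> real"
  assumes nonneg: "\<And>n. f n \<ge> 0" and subadd: "\<And>m n. f (m + n) \<le> f m + f n"
  shows "\<exists>L. (\<lambda>n. f n / real n) \<longlonglongrightarrow> L \<and> (\<forall>n. real n * L \<le> f n)"
proof -
  define L where "L = Inf ((\<lambda>n. f n / real n) ` {1..})"
  have bdd: "bdd_below ((\<lambda>n. f n / real n) ` {1..})"
    by (rule bdd_belowI[of _ 0]) (auto simp: nonneg)
  have lower: "L \<le> f n / real n" if "n \<ge> 1" for n
    unfolding L_def using that by (intro cInf_lower[OF _ bdd]) auto
  have "real n * L \<le> f n" for n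
  proof (cases "n = 0")
    case False
    then show ?thesis using lower[of n] by (simp add: field_simps)
  qed (use nonneg in simp)
  moreover have "(\<lambda>n. f n / real n) \<longlonglongrightarrow> L"
  proof (rule LIMSEQ_I)
    fix e :: real assume "e > 0"
    then have "Inf ((\<lambda>n. f n / real n) ` {1..}) < L + e / 2"
      by (simp add: L_def)
    then obtain m where m: "m \<ge> 1" "f m / real m < L + e / 2"
      using cInf_lessD[of "(\<lambda>n. f n / real n) ` {1..}" "L + e / 2"] by auto
    \<comment> \<open>Division with remainder by a nearly optimal \<open>m\<close>:
      \<open>f n\<close> is at most \<open>n div m\<close> copies of \<open>f m\<close> plus a
      bounded remainder.\<close>
    have iter: "f (q * m + r) \<le> real q * f m + f r" for q r
    proof (induction q)
      case (Suc q)
      have "f (Suc q * m + r) \<le> f m + f (q * m + r)"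
        using subadd[of m "q * m + r"] by (simp add: add.assoc)
      with Suc show ?case by (simp add: algebra_simps)
    qed simp
    define M where "M = (\<Sum>r<m. f r)"
    have M: "f r \<le> M" if "r < m" for r
      unfolding M_def using that by (intro member_le_sum) (auto simp: nonneg)
    show "\<exists>n0. \<forall>n\<ge>n0. norm (f n / real n - L) < e"
    \<comment> \<open>Beyond this threshold the remainder contributes less than \<open>e / 2\<close>
      after division by \<open>n\<close>.\<close>
    proof (intro exI[of _ "Suc (nat \<lceil>2 * M / e\<rceil>)"] allI impI)
      fix n assume n: "Suc (nat \<lceil>2 * M / e\<rceil>) \<le> n"
      then have n0: "n \<ge> 1" by simp
      have "2 * M / e < real n" using n by linarith
      then have Mn: "M / real n < e / 2"
        using \<open>e > 0\<close> n0 by (simp add: field_simps)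
      have "f n \<le> real (n div m) * f m + f (n mod m)"
        using iter[of "n div m" "n mod m"] by simp
      also have "\<dots> \<le> real (n div m) * f m + M"
        using M[of "n mod m"] m by simp
      finally have "f n / real n \<le> real (n div m) * f m / real n + M / real n"
        using n0 by (simp add: divide_right_mono flip: add_divide_distrib)
      also have "real (n div m) * f m / real n \<le> f m / real m"
      proof -
        have "real (n div m) * real m \<le> real n"
          by (metis of_nat_le_iff of_nat_mult times_div_less_eq_dividend mult.commute)
        then have "real (n div m) * real m * f m \<le> real n * f m"
          by (rule mult_right_mono) (rule nonneg)
        then show ?thesis using m n0 by (simp add: field_simps)
      qed
      finally have "f n / real n < L + e"
        using m Mn by linarith
      with lower[OF n0] \<open>e > 0\<close> show "norm (f n / real n - L) < e"
        by (simp add: abs_if)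
    qed
  qed
  ultimately show ?thesis by blast
qed

section \<open>Costs of powers and their growth rate\<close>

definition cost :: "'a :: field tensor3 \<Rightarrow> 'a tensor3 \<Rightarrow> nat \<Rightarrow> enat" where
  "cost t s n = Inf {enat m |m. restricts (kron_power t m) (kron_power s n)}"

lemma cost_le: "restricts (kron_power t m) (kron_power s n) \<Longrightarrow> cost t s n \<le> enat m"
  unfolding cost_def by (rule Inf_lower) blast

lemma cost_attained:
  assumes "cost t s n = enat m"
  shows "restricts (kron_power t m) (kron_power s n)"
proof -
  let ?S = "{enat m |m. restricts (kron_power t m) (kron_power s n)}"
  have "?S \<noteq> {}"
  proof
    assume "?S = {}"
    then have "cost t s n = \<infinity>" unfolding cost_def by (simp add: Inf_enat_def)
    with assms show False by simp
  qed
  then have "cost t s n \<in> ?S"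
    unfolding cost_def Inf_enat_def by (auto intro: LeastI)
  with assms show ?thesis by auto
qed

lemma cost_add: "cost t s (m + n) \<le> cost t s m + cost t s n"
proof (cases "cost t s m"; cases "cost t s n")
  fix a b assume *: "cost t s m = enat a" "cost t s n = enat b"
  have "cost t s (m + n) \<le> enat (a + b)"
    by (intro cost_le) (simp only: kron_power_add kron3_mono cost_attained *)
  with * show ?thesis by simp
qed simp_all

text \<open>For a nonzero target, surplus factors of a power can be projected to
  \<langle>1\<rangle>; this makes the cost at 1 a lower bound for all later costs.\<close>

definition nonzero_tensor :: "'a :: field tensor3 \<Rightarrow> bool" where
  "nonzero_tensor t \<longleftrightarrow> (\<exists>i j k. coord t i j k \<noteq> 0)"

lemma nonzero_tensor_kron3:
  assumes "nonzero_tensor t" "nonzero_tensor s"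
  shows "nonzero_tensor (kron3 t s)"
proof -
  obtain i j k where t: "coord t i j k \<noteq> 0"
    using assms(1) unfolding nonzero_tensor_def by blast
  obtain i' j' k' where s: "coord s i' j' k' \<noteq> 0"
    using assms(2) unfolding nonzero_tensor_def by blast
  from s have "i' < dim1 s" "j' < dim2 s" "k' < dim3 s"
    by (metis coord_outside)+
  from coord_kron3_pair[OF this, of t i j k] t s show ?thesis
    unfolding nonzero_tensor_def by (metis mult_eq_0_iff)
qed

lemma nonzero_tensor_unit: "n > 0 \<Longrightarrow> nonzero_tensor (unit_tensor n)"
  unfolding nonzero_tensor_def by (auto simp: coord_unit_tensor intro!: exI[of _ 0])

lemma nonzero_tensor_kron_power: "nonzero_tensor t \<Longrightarrow> nonzero_tensor (kron_power t n)"
  by (induction n) (simp_all add: nonzero_tensor_kron3 nonzero_tensor_unit)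

text \<open>Project onto a nonzero entry and divide by it.\<close>

lemma restricts_unit_1:
  assumes "nonzero_tensor t"
  shows "restricts t (unit_tensor 1)"
proof -
  obtain x y z where nz: "coord t x y z \<noteq> 0"
    using assms unfolding nonzero_tensor_def by blast
  then have xyz: "x < dim1 t" "y < dim2 t" "z < dim3 t"
    by (metis coord_outside)+
  let ?D = "\<lambda>x i. if i = x then 1 else (0 :: 'a)"
  have "(\<Sum>i<dim1 t. \<Sum>j<dim2 t. \<Sum>k<dim3 t.
      ?D x i * ?D y j * (?D z k * inverse (coord t x y z)) * coord t i j k) = 1"
    using xyz nz by (simp only: mult.assoc) (simp only: mult.assoc[symmetric, of "?D x _" "?D y _"]
      mult.assoc[symmetric, of "_ * _" "?D z _"] sum3_delta, simp)
  then show ?thesis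
    unfolding restricts_iff dim_unit_tensor
    by (intro exI[of _ "\<lambda>_. ?D x"] exI[of _ "\<lambda>_. ?D y"]
        exI[of _ "\<lambda>_ k. ?D z k * inverse (coord t x y z)"]) (simp add: coord_unit_tensor)
qed

text \<open>Hence either all costs are finite or all but the one at \<open>0\<close> are infinite.\<close>

lemma cost_Suc_ge:
  assumes "nonzero_tensor s"
  shows "cost t s 1 \<le> cost t s (Suc n)"
proof (cases "cost t s (Suc n)")
  case (enat m)
  have "restricts (kron_power s (Suc n)) (kron3 s (unit_tensor 1))"
    unfolding kron_power.simps
    by (intro kron3_mono restricts_refl restricts_unit_1 nonzero_tensor_kron_power assms)
  then have "restricts (kron_power t m) (kron_power s 1)"
    using cost_attained[OF enat] by (simp add: restricts_trans)
  with enat show ?thesis by (simp add: cost_le)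
qed simp

lemma cost_0 [simp]: "cost t s 0 = 0"
  using cost_le[of t 0 s 0] by (simp add: restricts_refl enat_0)

text \<open>If the cost at 1 is infinite, so are all positive costs, and the limit is \<infinity>.
  Otherwise subadditivity makes all costs finite and Fekete's lemma applies. Hence
  \<open>lim\<close> in the definition is an actual limit.\<close>

lemma rel_exponent_limit_and_lower_bound:
  assumes "nonzero_tensor s"
  shows "(\<lambda>n. ereal_of_enat (cost t s n) / ereal (real n)) \<longlonglongrightarrow> rel_exponent t s \<and>
    (\<forall>n. ereal (real n) * rel_exponent t s \<le> ereal_of_enat (cost t s n))"
proof (cases "cost t s 1")
  case infinity
  have inf: "cost t s n = \<infinity>" if "n \<ge> 1" for n
    using cost_Suc_ge[OF assms, of t "n - 1"] infinity that by simp
  have "(\<lambda>n. ereal_of_enat (cost t s n) / ereal (real n)) \<longlonglongrightarrow> \<infinity>"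
    \<comment> \<open>The index \<open>n = 0\<close>, where the cost is 0, has to be
      skipped.\<close>
    by (rule tendsto_eventually) (use inf in \<open>auto simp: eventually_sequentially intro!: exI[of _ 1]\<close>)
  moreover from this have "rel_exponent t s = \<infinity>"
    unfolding rel_exponent_def cost_def by (rule limI)
  ultimately show ?thesis
  proof (intro conjI allI, simp)
    fix n
    assume r: "rel_exponent t s = \<infinity>"
    \<comment> \<open>At \<open>n = 0\<close> both sides are 0, since 0 * \<infinity> = 0 in
      \<open>ereal\<close>.\<close>
    show "ereal (real n) * rel_exponent t s \<le> ereal_of_enat (cost t s n)"
      unfolding r using inf[of n] by (cases "n = 0") (simp_all flip: zero_ereal_def)
  qed
next
  case (enat b)
  have "cost t s n \<noteq> \<infinity>" for n
  proof (induction n)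
    case (Suc n)
    then obtain c where "cost t s n = enat c" by (cases "cost t s n") auto
    then have "cost t s (1 + n) \<le> enat (b + c)"
      using cost_add[of t s 1 n] enat by simp
    then show ?case by (metis infinity_ileE plus_1_eq_Suc)
  qed simp
  then have f: "cost t s n = enat (the_enat (cost t s n))" for n
    by (metis not_infinity_eq the_enat.simps)
  define f where "f n = the_enat (cost t s n)" for n
  note f = f[folded f_def]
  have "f (m + n) \<le> f m + f n" for m n
    using cost_add[of t s m n] by (simp add: f)
  then obtain L where L: "(\<lambda>n. real (f n) / real n) \<longlonglongrightarrow> L" "\<And>n. real n * L \<le> real (f n)"
    using subadditive_limit[of "\<lambda>n. real (f n)"] by (auto simp flip: of_nat_add)
  have "(\<lambda>n. ereal_of_enat (cost t s n) / ereal (real n)) \<longlonglongrightarrow> ereal L"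
  proof (rule Lim_transform_eventually)
    show "(\<lambda>n. ereal (real (f n) / real n)) \<longlonglongrightarrow> ereal L"
      using L(1) by simp
    show "\<forall>\<^sub>F n in sequentially. ereal (real (f n) / real n) = ereal_of_enat (cost t s n) / ereal (real n)"
      unfolding eventually_sequentially by (auto simp: f intro!: exI[of _ 1])
  qed
  moreover from this have "rel_exponent t s = ereal L"
    unfolding rel_exponent_def cost_def by (rule limI)
  ultimately show ?thesis
    using L(2) by (simp add: f)
qed

lemmas rel_exponent_limit = rel_exponent_limit_and_lower_bound[THEN conjunct1]
lemmas rel_exponent_lower_bound = rel_exponent_limit_and_lower_bound[THEN conjunct2, THEN spec]

lemma rel_exponent_nonneg:
  assumes "nonzero_tensor s"
  shows "rel_exponent t s \<ge> 0"
proof (rule LIMSEQ_le_const[OF rel_exponent_limit[OF assms]])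
  show "\<exists>N. \<forall>n\<ge>N. 0 \<le> ereal_of_enat (cost t s n) / ereal (real n)"
    by (intro exI[of _ 1] allI impI zero_le_divide_ereal) simp_all
qed

text \<open>Bounds along the multiples of \<open>n\<close> suffice, because a subsequence has the
  same limit. The product form admits infinite \<open>x\<close> without dividing extended
  reals.\<close>

lemma rel_exponent_geI:
  assumes s: "nonzero_tensor s" and n: "n \<ge> 1"
    and le: "\<And>k. k \<ge> 1 \<Longrightarrow> ereal (real k) * x \<le> ereal_of_enat (cost t s (n * k))"
  shows "x \<le> ereal (real n) * rel_exponent t s"
proof (rule LIMSEQ_le_const)
  have "filterlim (\<lambda>k. n * k) sequentially sequentially"
    by (rule filterlim_subseq) (use n in \<open>auto simp: strict_mono_def\<close>)
  with rel_exponent_limit[OF s, of t]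
  have "(\<lambda>k. ereal_of_enat (cost t s (n * k)) / ereal (real (n * k))) \<longlonglongrightarrow> rel_exponent t s"
    by (rule filterlim_compose)
  then show "(\<lambda>k. ereal (real n) * (ereal_of_enat (cost t s (n * k)) / ereal (real (n * k)))) \<longlonglongrightarrow>
      ereal (real n) * rel_exponent t s"
    by (rule tendsto_cmult_ereal[rotated]) simp
  show "\<exists>N. \<forall>k\<ge>N. x \<le> ereal (real n) * (ereal_of_enat (cost t s (n * k)) / ereal (real (n * k)))"
  proof (intro exI[of _ 1] allI impI)
    fix k :: nat assume k: "k \<ge> 1"
    show "x \<le> ereal (real n) * (ereal_of_enat (cost t s (n * k)) / ereal (real (n * k)))"
      using le[OF k] n k
      by (cases x; cases "cost t s (n * k)") (auto simp: field_simps)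
  qed
qed

text \<open>Discrete triangle inequality: a power of \<open>t\<close> that reaches
  \<open>n * k\<close> copies of \<open>s\<close> also reaches \<open>m * k\<close> copies of
  \<open>u\<close>, and the cost of the latter is at least \<open>m * k\<close> times the
  exponent.\<close>

lemma rel_exponent_restricts:
  assumes "nonzero_tensor s" "nonzero_tensor u" "n \<ge> 1"
    and r: "restricts (kron_power s n) (kron_power u m)"
  shows "ereal (real m) * rel_exponent t u \<le> ereal (real n) * rel_exponent t s"
proof (rule rel_exponent_geI)
  fix k :: nat
  have "cost t u (m * k) \<le> cost t s (n * k)"
  proof (cases "cost t s (n * k)")
    case (enat l)
    have "restricts (kron_power s (n * k)) (kron_power u (m * k))"
      unfolding kron_power_mult by (rule kron_power_mono[OF r])
    with cost_attained[OF enat] enat show ?thesis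
      by (metis cost_le restricts_trans)
  qed simp
  then have "ereal_of_enat (cost t u (m * k)) \<le> ereal_of_enat (cost t s (n * k))"
    by simp
  moreover have "ereal (real k) * (ereal (real m) * rel_exponent t u) \<le> ereal_of_enat (cost t u (m * k))"
    using rel_exponent_lower_bound[OF assms(2), of "m * k" t]
    by (metis mult.assoc mult.commute of_nat_mult times_ereal.simps(1))
  ultimately show "ereal (real k) * (ereal (real m) * rel_exponent t u) \<le> ereal_of_enat (cost t s (n * k))"
    by (rule order_trans[rotated])
qed (use assms in auto)

section \<open>Flattening ranks\<close>

text \<open>Padding \<open>P\<close> and \<open>Q\<close> with zeros to square matrices gives
  \<open>A * B = 1\<close>, hence \<open>B * A = 1\<close>; but the padding forces a zero at
  position \<open>(m, m)\<close> of \<open>B * A\<close>.\<close>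

lemma identity_factorization_dim:
  fixes P Q :: "nat \<Rightarrow> nat \<Rightarrow> 'a :: field"
  assumes id: "\<And>u v. u < n \<Longrightarrow> v < n \<Longrightarrow> (\<Sum>l<m. P u l * Q l v) = (if u = v then 1 else 0)"
  shows "n \<le> m"
proof (rule ccontr)
  assume "\<not> n \<le> m"
  then have mn: "m < n" by simp
  define A where "A = mat n n (\<lambda>(u, l). if l < m then P u l else 0)"
  define B where "B = mat n n (\<lambda>(l, v). if l < m then Q l v else 0)"
  have dims: "A \<in> carrier_mat n n" "B \<in> carrier_mat n n"
    by (simp_all add: A_def B_def)
  have "A * B = 1\<^sub>m n"
  proof (rule eq_matI)
    fix u v assume uv: "u < dim_row (1\<^sub>m n)" "v < dim_col (1\<^sub>m n)"
    then have "(A * B) $$ (u, v) =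
        (\<Sum>l\<in>{0..<n}. (if l < m then P u l else 0) * (if l < m then Q l v else 0))"
      by (simp add: A_def B_def scalar_prod_def)
    also have "\<dots> = (\<Sum>l<m. P u l * Q l v)"
      using mn by (intro sum.mono_neutral_cong_right) auto
    finally show "(A * B) $$ (u, v) = 1\<^sub>m n $$ (u, v)"
      using uv id by simp
  qed (simp_all add: A_def B_def)
  then have "B * A = 1\<^sub>m n"
    by (rule mat_mult_left_right_inverse[OF dims])
  then have "(B * A) $$ (m, m) = 1"
    using mn by simp
  moreover have "(B * A) $$ (m, m) = 0"
    using mn by (simp add: A_def B_def scalar_prod_def)
  ultimately show False by simp
qed

text \<open>
  Rank at least \<open>n\<close> of the flattening \<open>F^n1 \<otimes> (F^n2 \<otimes> F^n3)\<close>, witnessed by \<open>n\<close> columns \<open>(y v, z v)\<close> with a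
  left inverse \<open>X\<close>; in this form it is visibly multiplicative under Kronecker products.
\<close>

definition flattening_rank_ge :: "'a :: field tensor3 \<Rightarrow> nat \<Rightarrow> bool" where
  "flattening_rank_ge t n \<longleftrightarrow> (\<exists>X y z. \<forall>u<n. \<forall>v<n.
     y v < dim2 t \<and> z v < dim3 t \<and>
     (\<Sum>i<dim1 t. X u i * coord t i (y v) (z v)) = (if u = v then 1 else 0))"

lemma flattening_rank_ge_kron3:
  assumes "flattening_rank_ge t m" "flattening_rank_ge s n"
  shows "flattening_rank_ge (kron3 t s) (m * n)"
proof -
  obtain X y z where 1: "\<And>u v. u < m \<Longrightarrow> v < m \<Longrightarrow> y v < dim2 t \<and> z v < dim3 t \<and>
      (\<Sum>i<dim1 t. X u i * coord t i (y v) (z v)) = (if u = v then 1 else 0)"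
    using assms(1) unfolding flattening_rank_ge_def by blast
  obtain X' y' z' where 2: "\<And>u v. u < n \<Longrightarrow> v < n \<Longrightarrow> y' v < dim2 s \<and> z' v < dim3 s \<and>
      (\<Sum>i<dim1 s. X' u i * coord s i (y' v) (z' v)) = (if u = v then 1 else 0)"
    using assms(2) unfolding flattening_rank_ge_def by blast
  define Z where "Z u i = X (u div n) (i div dim1 s) * X' (u mod n) (i mod dim1 s)" for u i
  define Y where "Y v = y (v div n) * dim2 s + y' (v mod n)" for v
  define W where "W v = z (v div n) * dim3 s + z' (v mod n)" for v
  have "Y v < dim2 (kron3 t s) \<and> W v < dim3 (kron3 t s) \<and>
      (\<Sum>i<dim1 (kron3 t s). Z u i * coord (kron3 t s) i (Y v) (W v)) = (if u = v then 1 else 0)"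
    if u: "u < m * n" and v: "v < m * n" for u v
  proof -
    note uv = less_mult_div_mod[OF u] less_mult_div_mod[OF v]
    have b: "y (v div n) < dim2 t" "z (v div n) < dim3 t" "y' (v mod n) < dim2 s" "z' (v mod n) < dim3 s"
      using 1 2 uv by blast+
    have "coord (kron3 t s) i (Y v) (W v) = coord t (i div dim1 s) (y (v div n)) (z (v div n)) *
        coord s (i mod dim1 s) (y' (v mod n)) (z' (v mod n))" for i
      using b by (simp add: coord_kron3 Y_def W_def)
    then have "(\<Sum>i<dim1 (kron3 t s). Z u i * coord (kron3 t s) i (Y v) (W v)) =
        (\<Sum>i<dim1 t * dim1 s. (X (u div n) (i div dim1 s) * coord t (i div dim1 s) (y (v div n)) (z (v div n))) *
          (X' (u mod n) (i mod dim1 s) * coord s (i mod dim1 s) (y' (v mod n)) (z' (v mod n))))"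
      by (simp add: Z_def mult_ac)
    also have "\<dots> = (\<Sum>i<dim1 t. \<Sum>i'<dim1 s. (X (u div n) i * coord t i (y (v div n)) (z (v div n))) *
          (X' (u mod n) i' * coord s i' (y' (v mod n)) (z' (v mod n))))"
      by (rule sum_div_mod[where f = "\<lambda>i i'. (X (u div n) i * coord t i (y (v div n)) (z (v div n))) *
          (X' (u mod n) i' * coord s i' (y' (v mod n)) (z' (v mod n)))"])
    also have "\<dots> = (if u div n = v div n then 1 else 0) * (if u mod n = v mod n then 1 else 0)"
      using 1[OF uv(1,3)] 2[OF uv(2,4)] by (simp only: sum_product[symmetric])
    also have "\<dots> = (if u = v then 1 else 0)"
    proof -
      have "u = v \<longleftrightarrow> u div n = v div n \<and> u mod n = v mod n"
        by (metis div_mult_mod_eq)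
      then show ?thesis by simp
    qed
    finally show ?thesis
      using b by (simp add: Y_def W_def mult_add_less_mult)
  qed
  then show ?thesis
    unfolding flattening_rank_ge_def
    by (intro exI[of _ Z] exI[of _ Y] exI[of _ W]) simp
qed

lemma flattening_rank_ge_unit: "flattening_rank_ge (unit_tensor n) n"
proof -
  have "(\<Sum>i<n. (if i = u then 1 else 0) * coord (unit_tensor n) i v v) = (if u = v then 1 else (0 :: 'a))"
    if "u < n" for u v
    using that by (simp add: coord_unit_tensor if_distrib[of "\<lambda>x. x * _"] cong: if_cong)
  then show ?thesis
    unfolding flattening_rank_ge_def
    by (intro exI[of _ "\<lambda>u i. if i = u then 1 else 0"] exI[of _ id]) simp
qed

lemma flattening_rank_ge_kron_power:
  "flattening_rank_ge t m \<Longrightarrow> flattening_rank_ge (kron_power t n) (m ^ n)"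
  by (induction n) (use flattening_rank_ge_unit[of 1] in \<open>simp_all add: flattening_rank_ge_kron3\<close>)

text \<open>A restriction of \<open>unit_tensor m\<close> is a sum of \<open>m\<close> simple
  tensors, so its flattening factors through a space of dimension \<open>m\<close>.\<close>

lemma flattening_rank_ge_unit_restricts:
  assumes "restricts (unit_tensor m) s" "flattening_rank_ge s n"
  shows "n \<le> m"
proof -
  obtain A B C where "\<And>a b c. a < dim1 s \<Longrightarrow> b < dim2 s \<Longrightarrow> c < dim3 s \<Longrightarrow> coord s a b c =
      (\<Sum>i<m. \<Sum>j<m. \<Sum>k<m. A a i * B b j * C c k * coord (unit_tensor m) i j k)"
    using assms(1) unfolding restricts_iff by auto
  moreover have "(\<Sum>i<m. \<Sum>j<m. \<Sum>k<m. A a i * B b j * C c k * coord (unit_tensor m) i j k) =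
      (\<Sum>i<m. A a i * (B b i * C c i))" for a b c
  proof (rule sum.cong[OF refl])
    fix i assume i: "i \<in> {..<m}"
    have "(\<Sum>j<m. \<Sum>k<m. A a i * B b j * C c k * coord (unit_tensor m) i j k) =
        (\<Sum>j<m. \<Sum>k<m. if j = i then if k = i then A a i * (B b i * C c i) else 0 else 0)"
      using i by (intro sum.cong refl) (simp add: coord_unit_tensor)
    also have "\<dots> = (\<Sum>j<m. if j = i then A a i * (B b i * C c i) else 0)"
      using i by (intro sum.cong refl) simp
    finally show "(\<Sum>j<m. \<Sum>k<m. A a i * B b j * C c k * coord (unit_tensor m) i j k) =
        A a i * (B b i * C c i)"
      using i by simp
  qed
  ultimately have s: "\<And>a b c. a < dim1 s \<Longrightarrow> b < dim2 s \<Longrightarrow> c < dim3 s \<Longrightarrow>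
      coord s a b c = (\<Sum>l<m. A a l * (B b l * C c l))"
    by simp
  obtain X y z where r: "\<And>u v. u < n \<Longrightarrow> v < n \<Longrightarrow> y v < dim2 s \<and> z v < dim3 s \<and>
      (\<Sum>i<dim1 s. X u i * coord s i (y v) (z v)) = (if u = v then 1 else 0)"
    using assms(2) unfolding flattening_rank_ge_def by blast
  show ?thesis
  proof (rule identity_factorization_dim[where P = "\<lambda>u l. \<Sum>i<dim1 s. X u i * A i l"
        and Q = "\<lambda>l v. B (y v) l * C (z v) l"])
    fix u v assume uv: "u < n" "v < n"
    have "(\<Sum>i<dim1 s. X u i * coord s i (y v) (z v)) =
        (\<Sum>i<dim1 s. \<Sum>l<m. X u i * (A i l * (B (y v) l * C (z v) l)))"
      using r[OF uv] by (intro sum.cong refl) (simp add: s sum_distrib_left)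
    also have "\<dots> = (\<Sum>l<m. \<Sum>i<dim1 s. X u i * (A i l * (B (y v) l * C (z v) l)))"
      by (rule sum.swap)
    also have "\<dots> = (\<Sum>l<m. (\<Sum>i<dim1 s. X u i * A i l) * (B (y v) l * C (z v) l))"
      by (simp add: sum_distrib_right mult.assoc)
    finally show "(\<Sum>l<m. (\<Sum>i<dim1 s. X u i * A i l) * (B (y v) l * C (z v) l)) = (if u = v then 1 else 0)"
      using r[OF uv] by simp
  qed
qed

text \<open>Through this exchange the flattening along the second factor needs no definition of its
  own.\<close>

definition swap12 :: "'a :: field tensor3 \<Rightarrow> 'a tensor3" where
  "swap12 t = tensor3 (dim2 t) (dim1 t) (dim3 t) (\<lambda>i j k. coord t j i k)"

lemma dim_swap12 [simp]:
  "dim1 (swap12 t) = dim2 t" "dim2 (swap12 t) = dim1 t" "dim3 (swap12 t) = dim3 t"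
  by (simp_all add: swap12_def)

lemma coord_swap12 [simp]: "coord (swap12 t) i j k = coord t j i k"
  using coord_outside[of j t i k] by (auto simp: swap12_def coord_tensor3)

lemma swap12_kron3: "swap12 (kron3 t s) = kron3 (swap12 t) (swap12 s)"
  by (rule tensor3_eqI) (simp_all add: coord_kron3)

lemma swap12_unit [simp]: "swap12 (unit_tensor n) = unit_tensor n"
  by (rule tensor3_eqI) (auto simp: coord_unit_tensor)

lemma swap12_kron_power: "swap12 (kron_power t n) = kron_power (swap12 t) n"
  by (induction n) (simp_all add: swap12_kron3)

lemma restricts_swap12:
  assumes "restricts t s"
  shows "restricts (swap12 t) (swap12 s)"
proof -
  obtain A B C where *: "\<And>a b c. a < dim1 s \<Longrightarrow> b < dim2 s \<Longrightarrow> c < dim3 s \<Longrightarrow>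
      coord s a b c = (\<Sum>i<dim1 t. \<Sum>j<dim2 t. \<Sum>k<dim3 t. A a i * B b j * C c k * coord t i j k)"
    using assms unfolding restricts_iff by blast
  have "coord (swap12 s) b a c = (\<Sum>j<dim1 (swap12 t). \<Sum>i<dim2 (swap12 t). \<Sum>k<dim3 (swap12 t).
      B b j * A a i * C c k * coord (swap12 t) j i k)"
    if "a < dim2 (swap12 s)" "b < dim1 (swap12 s)" "c < dim3 (swap12 s)" for a b c
    using that by (simp add: * sum.swap[of _ "{..<dim1 t}" "{..<dim2 t}"] mult_ac)
  then show ?thesis
    unfolding restricts_iff by blast
qed

text \<open>The hypothesis is a nonvanishing 2 by 2 minor of the flattening, with rows
  \<open>i\<close>, \<open>i'\<close> and columns \<open>(j, k)\<close>,
  \<open>(j', k')\<close>.\<close>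

lemma flattening_rank_ge_2I:
  assumes "coord t i j k * coord t i' j' k' \<noteq> coord t i j' k' * coord t i' j k"
  shows "flattening_rank_ge t 2"
proof -
  define d where "d = coord t i j k * coord t i' j' k' - coord t i j' k' * coord t i' j k"
  have d: "d \<noteq> 0" using assms by (simp add: d_def)
  have b: "i < dim1 t" "i' < dim1 t" "j < dim2 t" "j' < dim2 t" "k < dim3 t" "k' < dim3 t"
    using assms by (metis coord_outside mult_zero_left mult_zero_right)+
  \<comment> \<open>The inverse of that 2 by 2 matrix by Cramer's rule, extended by zero. Being a
    sum of two terms, it can be evaluated before \<open>i\<close> and \<open>i'\<close> are known to
    differ.\<close>
  define X where "X u a =
      (if a = i then if u = 0 then coord t i' j' k' / d else - coord t i' j k / d else 0) +
      (if a = i' then if u = 0 then - coord t i j' k' / d else coord t i j k / d else 0)"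
    for u a :: nat
  define y where "y v = (if v = 0 then j else j')" for v :: nat
  define z where "z v = (if v = 0 then k else k')" for v :: nat
  have eval: "(\<Sum>a<dim1 t. X u a * T a) =
      (if u = 0 then coord t i' j' k' / d else - coord t i' j k / d) * T i +
      (if u = 0 then - coord t i j' k' / d else coord t i j k / d) * T i'" for u :: nat and T
    using b by (simp add: X_def distrib_right sum.distrib if_distrib[of "\<lambda>x. x * _"] cong: if_cong)
  have "y v < dim2 t \<and> z v < dim3 t \<and>
      (\<Sum>a<dim1 t. X u a * coord t a (y v) (z v)) = (if u = v then 1 else 0)"
    if "u < 2" "v < 2" for u v
    unfolding eval using that b d
    by (auto simp: y_def z_def less_2_cases_iff field_simps) (simp_all add: d_def algebra_simps)
  then show ?thesis
    unfolding flattening_rank_ge_def by blast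
qed

text \<open>
  If all 2 by 2 minors of two of the flattenings vanish, then \<open>t\<close> is the outer product of three of its fibres
  through a nonzero entry, suitably scaled.
\<close>

lemma not_simple_flattening_rank:
  assumes "\<not> simple_tensor t"
  shows "flattening_rank_ge t 2 \<or> flattening_rank_ge (swap12 t) 2"
proof (rule ccontr)
  assume "\<not> ?thesis"
  then have low: "\<not> flattening_rank_ge t 2" "\<not> flattening_rank_ge (swap12 t) 2"
    by auto
  have 1: "coord t i j k * coord t i' j' k' = coord t i j' k' * coord t i' j k" for i j k i' j' k'
    using low(1) flattening_rank_ge_2I[of t i j k i' j' k'] by blast
  have 2: "coord t i j k * coord t i' j' k' = coord t i' j k' * coord t i j' k" for i j k i' j' k'
    using low(2) flattening_rank_ge_2I[of "swap12 t" j i k j' i' k'] by auto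
  have "simple_tensor t"
  proof (cases "\<exists>x y z. coord t x y z \<noteq> 0")
    case True
    then obtain x y z where c: "coord t x y z \<noteq> 0" by blast
    have factor: "coord t i j k = coord t i y z * (coord t x j z / coord t x y z) * (coord t x y k / coord t x y z)"
      for i j k
    proof -
      have "coord t i j k * coord t x y z = coord t i y z * coord t x j k"
        by (rule 1)
      moreover have "coord t x j k * coord t x y z = coord t x j z * coord t x y k"
        by (rule 2)
      ultimately have "coord t i j k * coord t x y z * coord t x y z =
          coord t i y z * (coord t x j z * coord t x y k)"
        by (metis mult.assoc)
      then show ?thesis using c by (simp add: field_simps)
    qed
    have "t = outer3 (vec (dim1 t) (\<lambda>i. coord t i y z)) (vec (dim2 t) (\<lambda>j. coord t x j z / coord t x y z))
        (vec (dim3 t) (\<lambda>k. coord t x y k / coord t x y z))" (is "t = ?s")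
    proof (rule tensor3_eqI)
      fix i j k assume "i < dim1 ?s" "j < dim2 ?s" "k < dim3 ?s"
      then show "coord t i j k = coord ?s i j k"
        by (subst factor) (simp add: outer3_def coord_tensor3)
    qed (simp_all add: outer3_def)
    then show ?thesis unfolding simple_tensor_def by blast
  next
    case False
    then have "t = outer3 (0\<^sub>v (dim1 t)) (0\<^sub>v (dim2 t)) (0\<^sub>v (dim3 t))"
      by (intro tensor3_eqI) (simp_all add: outer3_def coord_tensor3)
    then show ?thesis unfolding simple_tensor_def by blast
  qed
  with assms show False by blast
qed

lemma flattening_rank_ge_nonzero:
  assumes "flattening_rank_ge t n" "n > 0"
  shows "nonzero_tensor t"
proof (rule ccontr)
  assume "\<not> nonzero_tensor t"
  then have "coord t i j k = 0" for i j k
    unfolding nonzero_tensor_def by blast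
  moreover obtain X y z where "\<And>u v. u < n \<Longrightarrow> v < n \<Longrightarrow> y v < dim2 t \<and> z v < dim3 t \<and>
      (\<Sum>i<dim1 t. X u i * coord t i (y v) (z v)) = (if u = v then 1 else 0)"
    using assms(1) unfolding flattening_rank_ge_def by blast
  from this[OF assms(2) assms(2)] have "(\<Sum>i<dim1 t. X 0 i * coord t i (y 0) (z 0)) = 1"
    by simp
  ultimately show False by simp
qed

lemma not_simple_nonzero:
  assumes "\<not> simple_tensor t"
  shows "nonzero_tensor t"
proof -
  have "nonzero_tensor (swap12 t) \<Longrightarrow> nonzero_tensor t"
    unfolding nonzero_tensor_def by auto
  with not_simple_flattening_rank[OF assms] show ?thesis
    by (metis flattening_rank_ge_nonzero zero_less_numeral)
qed

text \<open>Compare flattening ranks: at least \<open>2 ^ n\<close> for the target, at most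
  \<open>2 ^ m\<close> for any restriction of \<langle>2\<rangle>^m.\<close>

lemma unit_power_restricts_flattening:
  assumes "flattening_rank_ge t 2" "restricts (kron_power (unit_tensor 2) m) (kron_power t n)"
  shows "n \<le> m"
proof -
  have "(2 :: nat) ^ n \<le> 2 ^ m"
    using assms by (intro flattening_rank_ge_unit_restricts[of _ "kron_power t n"]
        flattening_rank_ge_kron_power) (simp_all add: kron_power_unit)
  then show ?thesis by simp
qed

text \<open>Whichever flattening has rank at least 2 shows that \<open>n\<close> copies of
  \<open>t\<close> cost at least \<open>n\<close>. For \<open>t = unit_tensor 2\<close> this is
  \<omega>(\<langle>2\<rangle>, \<langle>2\<rangle>) \<ge> 1.\<close>

lemma rel_exponent_unit_ge_1:
  assumes "flattening_rank_ge t 2 \<or> flattening_rank_ge (swap12 t) 2" "nonzero_tensor t"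
  shows "1 \<le> rel_exponent (unit_tensor 2) t"
proof -
  have "n \<le> m" if "restricts (kron_power (unit_tensor 2) m) (kron_power t n)" for m n
    using assms(1)
  proof
    assume "flattening_rank_ge t 2"
    then show ?thesis using that by (rule unit_power_restricts_flattening)
  next
    assume "flattening_rank_ge (swap12 t) 2"
    moreover have "restricts (kron_power (unit_tensor 2) m) (kron_power (swap12 t) n)"
      using restricts_swap12[OF that] by (simp add: swap12_kron_power)
    ultimately show ?thesis by (rule unit_power_restricts_flattening)
  qed
  then have "ereal (real k) * 1 \<le> ereal_of_enat (cost (unit_tensor 2) t k)" for k
    by (cases "cost (unit_tensor 2) t k") (auto dest!: cost_attained)
  then have "1 \<le> ereal (real 1) * rel_exponent (unit_tensor 2) t"
    by (intro rel_exponent_geI assms) auto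
  then show ?thesis by simp
qed

text \<open>With \<open>m\<close> the product of the three dimensions, \<langle>2\<rangle>^m =
  \<langle>2^m\<rangle> restricts to \<langle>m\<rangle>, which restricts to
  \<open>t\<close>.\<close>

lemma rel_exponent_unit_finite:
  assumes "nonzero_tensor t"
  shows "rel_exponent (unit_tensor 2) t < \<infinity>"
proof -
  define m where "m = dim1 t * dim2 t * dim3 t"
  have "restricts (kron_power (unit_tensor 2) m) (kron_power t 1)"
    using restricts_trans[OF restricts_unit_mono[of m "2 ^ m"] unit_restricts[of t, folded m_def]]
    by (simp add: kron_power_unit less_imp_le)
  then have "cost (unit_tensor 2) t 1 \<le> enat m"
    by (rule cost_le)
  then have "ereal_of_enat (cost (unit_tensor 2) t 1) \<le> ereal_of_enat (enat m)"
    by (simp only: ereal_of_enat_le_iff)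
  with rel_exponent_lower_bound[OF assms, of 1 "unit_tensor 2"] show ?thesis
    by (cases "rel_exponent (unit_tensor 2) t") auto
qed

text \<open>Let \<open>x\<close> be \<omega>(\<langle>2\<rangle>, t), which is finite and positive.
  If t^m restricts to \<langle>2\<rangle>^k, the triangle inequality through \<open>t\<close> gives
  k \<le> m x, so the cost of \<langle>2\<rangle>^k is at least \<open>k / x\<close>.\<close>

lemma irreversibility_ge_1:
  assumes "\<not> simple_tensor t"
  shows "1 \<le> irreversibility t"
proof -
  note nz = not_simple_nonzero[OF assms]
  have unit: "1 \<le> rel_exponent (unit_tensor 2) (unit_tensor 2 :: 'a tensor3)"
    by (intro rel_exponent_unit_ge_1 disjI1 flattening_rank_ge_unit nonzero_tensor_unit) simp
  have one: "1 \<le> rel_exponent (unit_tensor 2) t"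
    using not_simple_flattening_rank[OF assms] nz by (rule rel_exponent_unit_ge_1)
  then obtain x where x: "rel_exponent (unit_tensor 2) t = ereal x" "x \<ge> 1"
    using rel_exponent_unit_finite[OF nz] by (cases "rel_exponent (unit_tensor 2) t") auto
  have "ereal (real k) * ereal (1 / x) \<le> ereal_of_enat (cost t (unit_tensor 2) (1 * k))" if k: "k \<ge> 1" for k
  proof (cases "cost t (unit_tensor 2) k")
    case (enat m)
    have r: "restricts (kron_power t m) (kron_power (unit_tensor 2) k)"
      using enat by (rule cost_attained)
    \<comment> \<open>The triangle inequality is applied with a positive power of \<open>t\<close>.
      The zeroth power is \<langle>1\<rangle>, whose flattening rank is too small for
      \<open>k \<ge> 1\<close>.\<close>
    have "m \<ge> 1"
    proof (rule ccontr)
      assume "\<not> m \<ge> 1"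
      then have "m = 0" by simp
      with r have "restricts (kron_power (unit_tensor 2) 0) (kron_power (unit_tensor 2 :: 'a tensor3) k)"
        by simp
      from unit_power_restricts_flattening[OF flattening_rank_ge_unit this] k show False by simp
    qed
    with r have "ereal (real k) * rel_exponent (unit_tensor 2) (unit_tensor 2 :: 'a tensor3) \<le> ereal (real m) * ereal x"
      unfolding x(1)[symmetric] by (intro rel_exponent_restricts nz nonzero_tensor_unit) auto
    moreover have "ereal (real k) * 1 \<le> ereal (real k) * rel_exponent (unit_tensor 2) (unit_tensor 2 :: 'a tensor3)"
      by (rule ereal_mult_left_mono[OF unit]) simp
    ultimately have "ereal (real k) * 1 \<le> ereal (real m) * ereal x"
      by (rule order_trans[rotated])
    then show ?thesis using x enat by (simp add: field_simps)
  qed simp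
  then have "ereal (1 / x) \<le> ereal (real 1) * rel_exponent t (unit_tensor 2)"
    by (intro rel_exponent_geI nonzero_tensor_unit) auto
  then show ?thesis
    unfolding irreversibility_def x(1) using x(2)
    by (cases "rel_exponent t (unit_tensor 2)") (auto simp: field_simps)
qed

section \<open>Monomial degeneration of matrix multiplication tensors\<close>

text \<open>
  \<open>s\<close> contains \<open>\<langle>L\<rangle> \<otimes> \<langle>n,n,n\<rangle>\<close> as a subtensor up to relabelling of the basis vectors.
\<close>

definition contains_matmul :: "'a :: field tensor3 \<Rightarrow> nat \<Rightarrow> nat \<Rightarrow> bool" where
  "contains_matmul s L n \<longleftrightarrow> (\<exists>a b c.
     (\<forall>l<L. \<forall>i<n. \<forall>j<n. a l i j < dim1 s \<and> b l i j < dim2 s \<and> c l i j < dim3 s) \<and>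
     (\<forall>l<L. \<forall>l'<L. \<forall>l''<L. \<forall>i<n. \<forall>i'<n. \<forall>j<n. \<forall>j'<n. \<forall>k<n. \<forall>k'<n. coord s (a l i j) (b l' j' k) (c l'' k' i') =
       (if l = l' \<and> l' = l'' \<and> i = i' \<and> j = j' \<and> k = k' then 1 else 0)))"

lemma contains_matmulE:
  assumes "contains_matmul s L n"
  obtains a b c where
    "\<And>l i j. l < L \<Longrightarrow> i < n \<Longrightarrow> j < n \<Longrightarrow> a l i j < dim1 s"
    "\<And>l j k. l < L \<Longrightarrow> j < n \<Longrightarrow> k < n \<Longrightarrow> b l j k < dim2 s"
    "\<And>l k i. l < L \<Longrightarrow> k < n \<Longrightarrow> i < n \<Longrightarrow> c l k i < dim3 s"
    "\<And>l l' l'' i i' j j' k k'. l < L \<Longrightarrow> l' < L \<Longrightarrow> l'' < L \<Longrightarrow> i < n \<Longrightarrow> i' < n \<Longrightarrow> j < n \<Longrightarrow>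
      j' < n \<Longrightarrow> k < n \<Longrightarrow> k' < n \<Longrightarrow> coord s (a l i j) (b l' j' k) (c l'' k' i') =
       (if l = l' \<and> l' = l'' \<and> i = i' \<and> j = j' \<and> k = k' then 1 else 0)"
proof -
  obtain a b c where
    "\<forall>l<L. \<forall>i<n. \<forall>j<n. a l i j < dim1 s \<and> b l i j < dim2 s \<and> c l i j < dim3 s"
    "\<forall>l<L. \<forall>l'<L. \<forall>l''<L. \<forall>i<n. \<forall>i'<n. \<forall>j<n. \<forall>j'<n. \<forall>k<n. \<forall>k'<n.
      coord s (a l i j) (b l' j' k) (c l'' k' i') =
        (if l = l' \<and> l' = l'' \<and> i = i' \<and> j = j' \<and> k = k' then 1 else 0)"
    using assms unfolding contains_matmul_def by (elim exE conjE) (rule that)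
  then show thesis
    by (intro that[of a b c]) simp_all
qed

text \<open>Both the number of summands and the matrix size multiply; each label splits into a
  quotient and a remainder.\<close>

lemma contains_matmul_kron3:
  assumes "contains_matmul t L m" "contains_matmul s M n"
  shows "contains_matmul (kron3 t s) (L * M) (m * n)"
proof -
  obtain a b c where 1:
    "\<And>l i j. l < L \<Longrightarrow> i < m \<Longrightarrow> j < m \<Longrightarrow> a l i j < dim1 t"
    "\<And>l j k. l < L \<Longrightarrow> j < m \<Longrightarrow> k < m \<Longrightarrow> b l j k < dim2 t"
    "\<And>l k i. l < L \<Longrightarrow> k < m \<Longrightarrow> i < m \<Longrightarrow> c l k i < dim3 t"
    "\<And>l l' l'' i i' j j' k k'. l < L \<Longrightarrow> l' < L \<Longrightarrow> l'' < L \<Longrightarrow> i < m \<Longrightarrow> i' < m \<Longrightarrow> j < m \<Longrightarrow>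
      j' < m \<Longrightarrow> k < m \<Longrightarrow> k' < m \<Longrightarrow> coord t (a l i j) (b l' j' k) (c l'' k' i') =
       (if l = l' \<and> l' = l'' \<and> i = i' \<and> j = j' \<and> k = k' then 1 else 0)"
    using assms(1) by (elim contains_matmulE) (rule that)
  obtain a' b' c' where 2:
    "\<And>l i j. l < M \<Longrightarrow> i < n \<Longrightarrow> j < n \<Longrightarrow> a' l i j < dim1 s"
    "\<And>l j k. l < M \<Longrightarrow> j < n \<Longrightarrow> k < n \<Longrightarrow> b' l j k < dim2 s"
    "\<And>l k i. l < M \<Longrightarrow> k < n \<Longrightarrow> i < n \<Longrightarrow> c' l k i < dim3 s"
    "\<And>l l' l'' i i' j j' k k'. l < M \<Longrightarrow> l' < M \<Longrightarrow> l'' < M \<Longrightarrow> i < n \<Longrightarrow> i' < n \<Longrightarrow> j < n \<Longrightarrow>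
      j' < n \<Longrightarrow> k < n \<Longrightarrow> k' < n \<Longrightarrow> coord s (a' l i j) (b' l' j' k) (c' l'' k' i') =
       (if l = l' \<and> l' = l'' \<and> i = i' \<and> j = j' \<and> k = k' then 1 else 0)"
    using assms(2) by (elim contains_matmulE) (rule that)
  define A where "A l i j = a (l div M) (i div n) (j div n) * dim1 s + a' (l mod M) (i mod n) (j mod n)" for l i j
  define B where "B l i j = b (l div M) (i div n) (j div n) * dim2 s + b' (l mod M) (i mod n) (j mod n)" for l i j
  define C where "C l i j = c (l div M) (i div n) (j div n) * dim3 s + c' (l mod M) (i mod n) (j mod n)" for l i j
  have eq: "u = v \<longleftrightarrow> u div d = v div d \<and> u mod d = v mod d" for u v d :: nat
    by (metis div_mult_mod_eq)
  have main: "coord (kron3 t s) (A l i j) (B l' j' k) (C l'' k' i') =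
       (if l = l' \<and> l' = l'' \<and> i = i' \<and> j = j' \<and> k = k' then 1 else 0)"
    if "l < L * M" "l' < L * M" "l'' < L * M" "i < m * n" "i' < m * n" "j < m * n" "j' < m * n" "k < m * n" "k' < m * n"
    for l l' l'' i i' j j' k k'
  proof -
    note b = that[THEN less_mult_div_mod(1)] that[THEN less_mult_div_mod(2)]
    have "coord (kron3 t s) (A l i j) (B l' j' k) (C l'' k' i') =
      (if l div M = l' div M \<and> l' div M = l'' div M \<and> i div n = i' div n \<and> j div n = j' div n \<and> k div n = k' div n
         then 1 else 0) *
      (if l mod M = l' mod M \<and> l' mod M = l'' mod M \<and> i mod n = i' mod n \<and> j mod n = j' mod n \<and> k mod n = k' mod n
         then 1 else 0)"
      using b by (simp add: A_def B_def C_def coord_kron3_pair 1(4) 2(1-4))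
    also have "\<dots> = (if l = l' \<and> l' = l'' \<and> i = i' \<and> j = j' \<and> k = k' then 1 else 0)"
      by (simp add: eq[of l l' M] eq[of l' l'' M] eq[of i i' n] eq[of j j' n] eq[of k k' n])
    finally show ?thesis .
  qed
  have dims: "A l i j < dim1 (kron3 t s) \<and> B l i j < dim2 (kron3 t s) \<and> C l i j < dim3 (kron3 t s)"
    if "l < L * M" "i < m * n" "j < m * n" for l i j
    using that[THEN less_mult_div_mod(1)] that[THEN less_mult_div_mod(2)]
    by (simp add: A_def B_def C_def mult_add_less_mult 1(1-3) 2(1-3))
  show ?thesis
    unfolding contains_matmul_def
    by (rule exI[of _ A], rule exI[of _ B], rule exI[of _ C], rule conjI)
      (intro allI impI, rule dims, assumption+, intro allI impI, rule main, assumption+)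
qed

lemma contains_matmul_unit: "contains_matmul (unit_tensor n) n 1"
  unfolding contains_matmul_def
  by (intro exI[of _ "\<lambda>l _ _. l"]) (simp add: coord_unit_tensor)

lemma contains_matmul_matmul: "contains_matmul (matmul_tensor n n n) 1 n"
proof -
  let ?c = "\<lambda>i j :: nat. i * n + j"
  \<comment> \<open>Numbering row by row is injective, so at most one summand of the matrix
    multiplication tensor survives at a given position.\<close>
  have eq: "?c i j = ?c i' j' \<longleftrightarrow> i = i' \<and> j = j'" if "j < n" "j' < n" for i j i' j'
  proof -
    have "?c i j div n = i" "?c i j mod n = j" "?c i' j' div n = i'" "?c i' j' mod n = j'"
      using that by simp_all
    then show ?thesis by metis
  qed
  have "coord (matmul_tensor n n n :: 'a tensor3) (?c i j) (?c j' k) (?c k' i') =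
        (if i = i' \<and> j = j' \<and> k = k' then 1 else 0)"
    if b: "i < n" "i' < n" "j < n" "j' < n" "k < n" "k' < n" for i i' j j' k k'
  proof -
    have "coord (matmul_tensor n n n :: 'a tensor3) (?c i j) (?c j' k) (?c k' i') =
        (\<Sum>x<n. \<Sum>y<n. \<Sum>z<n. if ?c i j = ?c x y \<and> ?c j' k = ?c y z \<and> ?c k' i' = ?c z x then 1 else 0)"
      using b by (simp add: matmul_tensor_def coord_tensor3 mult_add_less_mult)
    also have "\<dots> = (\<Sum>x<n. \<Sum>y<n. \<Sum>z<n. (if x = i then 1 else 0) * (if y = j then 1 else 0) *
        (if z = k then 1 else 0) * (if i = i' \<and> j = j' \<and> k = k' then 1 else 0))"
      using b by (intro sum.cong refl) (auto simp: eq)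
    also have "\<dots> = (if i = i' \<and> j = j' \<and> k = k' then 1 else 0)"
      using b by (simp only: sum3_delta) simp
    finally show ?thesis .
  qed
  then show ?thesis
    unfolding contains_matmul_def
    by (intro exI[of _ "\<lambda>_. ?c"]) (simp add: matmul_tensor_def mult_add_less_mult)
qed

lemma contains_matmul_kron_power:
  "contains_matmul t L m \<Longrightarrow> contains_matmul (kron_power t n) (L ^ n) (m ^ n)"
  by (induction n) (use contains_matmul_unit[of 1] in \<open>simp_all add: contains_matmul_kron3\<close>)

text \<open>
  The weights are the exponents of \<open>\<epsilon>\<close> in a monomial degeneration of \<open>s\<close> to \<open>\<langle>r\<rangle>\<close>: the diagonal has
  exponent 0 and all other nonzero entries have positive exponent.
\<close>

definition combinatorial_degeneration :: "'a :: field tensor3 \<Rightarrow> nat \<Rightarrow> nat \<Rightarrow> bool" where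
  "combinatorial_degeneration s r B \<longleftrightarrow> (\<exists>a b c. \<exists>f g h :: nat \<Rightarrow> int.
     (\<forall>u<r. a u < dim1 s \<and> b u < dim2 s \<and> c u < dim3 s \<and>
       coord s (a u) (b u) (c u) = 1 \<and> f u + g u + h u = 0 \<and> \<bar>f u\<bar> \<le> int B \<and> \<bar>g u\<bar> \<le> int B) \<and>
     (\<forall>u<r. \<forall>v<r. \<forall>w<r. coord s (a u) (b v) (c w) \<noteq> 0 \<longrightarrow> \<not> (u = v \<and> v = w) \<longrightarrow> f u + g v + h w > 0))"

text \<open>Weights add. A triple off the diagonal is off the diagonal in at least one factor, which
  contributes a positive weight, while the other contributes a nonnegative one.\<close>

lemma combinatorial_degeneration_kron3:
  assumes "combinatorial_degeneration t m B" "combinatorial_degeneration s n B'"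
  shows "combinatorial_degeneration (kron3 t s) (m * n) (B + B')"
proof -
  obtain a b c and f g h :: "nat \<Rightarrow> int" where
    1: "\<And>u. u < m \<Longrightarrow> a u < dim1 t \<and> b u < dim2 t \<and> c u < dim3 t \<and>
       coord t (a u) (b u) (c u) = 1 \<and> f u + g u + h u = 0 \<and> \<bar>f u\<bar> \<le> int B \<and> \<bar>g u\<bar> \<le> int B"
    and p1: "\<And>u v w. u < m \<Longrightarrow> v < m \<Longrightarrow> w < m \<Longrightarrow> coord t (a u) (b v) (c w) \<noteq> 0 \<Longrightarrow>
      \<not> (u = v \<and> v = w) \<Longrightarrow> f u + g v + h w > 0"
    using assms(1) unfolding combinatorial_degeneration_def by blast
  obtain a' b' c' and f' g' h' :: "nat \<Rightarrow> int" where
    2: "\<And>u. u < n \<Longrightarrow> a' u < dim1 s \<and> b' u < dim2 s \<and> c' u < dim3 s \<and>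
       coord s (a' u) (b' u) (c' u) = 1 \<and> f' u + g' u + h' u = 0 \<and> \<bar>f' u\<bar> \<le> int B' \<and> \<bar>g' u\<bar> \<le> int B'"
    and p2: "\<And>u v w. u < n \<Longrightarrow> v < n \<Longrightarrow> w < n \<Longrightarrow> coord s (a' u) (b' v) (c' w) \<noteq> 0 \<Longrightarrow>
      \<not> (u = v \<and> v = w) \<Longrightarrow> f' u + g' v + h' w > 0"
    using assms(2) unfolding combinatorial_degeneration_def by blast
  define F where "F f f' u = f (u div n) + f' (u mod n)" for f f' :: "nat \<Rightarrow> int" and u
  define A where "A a a' d u = a (u div n) * d + a' (u mod n)" for a a' :: "nat \<Rightarrow> nat" and d u
  have eq: "u = v \<longleftrightarrow> u div n = v div n \<and> u mod n = v mod n" for u v :: nat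
    by (metis div_mult_mod_eq)
  have coord: "coord (kron3 t s) (A a a' (dim1 s) u) (A b b' (dim2 s) v) (A c c' (dim3 s) w) =
      coord t (a (u div n)) (b (v div n)) (c (w div n)) * coord s (a' (u mod n)) (b' (v mod n)) (c' (w mod n))"
    if "u < m * n" "v < m * n" "w < m * n" for u v w
    using that[THEN less_mult_div_mod(2)] by (simp add: A_def coord_kron3_pair 2)
  have diag: "A a a' (dim1 s) u < dim1 (kron3 t s) \<and> A b b' (dim2 s) u < dim2 (kron3 t s) \<and>
      A c c' (dim3 s) u < dim3 (kron3 t s) \<and>
      coord (kron3 t s) (A a a' (dim1 s) u) (A b b' (dim2 s) u) (A c c' (dim3 s) u) = 1 \<and>
      F f f' u + F g g' u + F h h' u = 0 \<and> \<bar>F f f' u\<bar> \<le> int (B + B') \<and> \<bar>F g g' u\<bar> \<le> int (B + B')"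
    if u: "u < m * n" for u
    using 1[OF less_mult_div_mod(1)[OF u]] 2[OF less_mult_div_mod(2)[OF u]]
    unfolding coord[OF u u u] by (auto simp: A_def F_def mult_add_less_mult)
  have pos: "F f f' u + F g g' v + F h h' w > 0"
    if b: "u < m * n" "v < m * n" "w < m * n"
      and nz: "coord (kron3 t s) (A a a' (dim1 s) u) (A b b' (dim2 s) v) (A c c' (dim3 s) w) \<noteq> 0"
      and ne: "\<not> (u = v \<and> v = w)" for u v w
  proof -
    note d = b[THEN less_mult_div_mod(1)] and r = b[THEN less_mult_div_mod(2)]
    have nz: "coord t (a (u div n)) (b (v div n)) (c (w div n)) \<noteq> 0"
      "coord s (a' (u mod n)) (b' (v mod n)) (c' (w mod n)) \<noteq> 0"
      using nz unfolding coord[OF b] by auto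
    have "f (u div n) + g (v div n) + h (w div n) \<ge> 0"
      using 1[OF d(1)] p1[OF d nz(1)] by (cases "u div n = v div n \<and> v div n = w div n") force+
    moreover have "f' (u mod n) + g' (v mod n) + h' (w mod n) \<ge> 0"
      using 2[OF r(1)] p2[OF r nz(2)] by (cases "u mod n = v mod n \<and> v mod n = w mod n") force+
    moreover have "f (u div n) + g (v div n) + h (w div n) > 0 \<or> f' (u mod n) + g' (v mod n) + h' (w mod n) > 0"
      using ne p1[OF d nz(1)] p2[OF r nz(2)] unfolding eq[of u v] eq[of v w] by blast
    ultimately show ?thesis by (auto simp: F_def)
  qed
  show ?thesis
    unfolding combinatorial_degeneration_def
    by (rule exI[of _ "A a a' (dim1 s)"], rule exI[of _ "A b b' (dim2 s)"], rule exI[of _ "A c c' (dim3 s)"],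
        rule exI[of _ "F f f'"], rule exI[of _ "F g g'"], rule exI[of _ "F h h'"], rule conjI)
      (intro allI impI, rule diag, assumption, intro allI impI, rule pos, assumption+)
qed

lemma combinatorial_degeneration_unit: "combinatorial_degeneration (unit_tensor n) n 0"
  unfolding combinatorial_degeneration_def
  by (intro exI[of _ id] exI[of _ "\<lambda>_. 0"]) (auto simp: coord_unit_tensor split: if_splits)

text \<open>The diagonal grows exponentially but the bound on the weights only linearly; this makes
  the later pigeonhole loss negligible.\<close>

lemma combinatorial_degeneration_kron_power:
  "combinatorial_degeneration t m B \<Longrightarrow> combinatorial_degeneration (kron_power t n) (m ^ n) (n * B)"
  by (induction n) (use combinatorial_degeneration_unit[of 1] in \<open>simp_all add: combinatorial_degeneration_kron3\<close>)

text \<open>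
  On a set of labels on which \<open>f\<close> and \<open>g\<close> are constant, so is \<open>h = - f - g\<close>; all total weights
  vanish there and hence only the diagonal survives.
\<close>

lemma combinatorial_degeneration_restricts:
  assumes "combinatorial_degeneration s m B" "r * (2 * B + 1) ^ 2 \<le> m"
  shows "restricts s (unit_tensor r)"
proof -
  obtain a b c and f g h :: "nat \<Rightarrow> int" where
    1: "\<And>u. u < m \<Longrightarrow> a u < dim1 s \<and> b u < dim2 s \<and> c u < dim3 s \<and>
       coord s (a u) (b u) (c u) = 1 \<and> f u + g u + h u = 0 \<and> \<bar>f u\<bar> \<le> int B \<and> \<bar>g u\<bar> \<le> int B"
    and 2: "\<And>u v w. u < m \<Longrightarrow> v < m \<Longrightarrow> w < m \<Longrightarrow> coord s (a u) (b v) (c w) \<noteq> 0 \<Longrightarrow>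
      \<not> (u = v \<and> v = w) \<Longrightarrow> f u + g v + h w > 0"
    using assms(1) unfolding combinatorial_degeneration_def by blast
  let ?I = "{- int B..int B} \<times> {- int B..int B}"
  let ?S = "\<lambda>p. {u \<in> {..<m}. (f u, g u) = p}"
  \<comment> \<open>Pigeonhole: the \<open>m\<close> labels share at most
    \<open>(2 * B + 1) ^ 2\<close> pairs of values of \<open>f\<close> and \<open>g\<close>.\<close>
  have "\<exists>p\<in>?I. r \<le> card (?S p)"
  proof (rule ccontr)
    assume "\<not> ?thesis"
    then have small: "card (?S p) < r" if "p \<in> ?I" for p
      using that by force
    have "m = card (\<Union>p\<in>?I. ?S p)"
    proof -
      have "(\<Union>p\<in>?I. ?S p) = {..<m}"
        using 1 by (auto simp: abs_le_iff) (metis minus_le_iff)+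
      then show ?thesis by simp
    qed
    also have "\<dots> \<le> (\<Sum>p\<in>?I. card (?S p))"
      by (rule card_UN_le) simp
    also have "\<dots> < (\<Sum>p\<in>?I. r)"
      using small by (intro sum_strict_mono) auto
    also have "\<dots> = r * (2 * B + 1) ^ 2"
    proof -
      have "card {- int B..int B} = 2 * B + 1"
        unfolding card_atLeastAtMost_int by linarith
      then show ?thesis by (simp add: card_cartesian_product power2_eq_square)
    qed
    finally show False using assms(2) by simp
  qed
  then obtain x y where xy: "r \<le> card (?S (x, y))" by blast
  obtain T where T: "T \<subseteq> ?S (x, y)" "card T = r" "finite T"
    using obtain_subset_with_card_n[OF xy] by blast
  obtain e where "bij_betw e {0..<r} T"
    using ex_bij_betw_nat_finite[OF T(3)] T(2) by blast
  then have inj: "inj_on e {0..<r}" and e: "\<And>u. u < r \<Longrightarrow> e u \<in> T"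
    by (auto simp: bij_betw_def)
  have em: "e u < m" and fe: "f (e u) = x" and ge: "g (e u) = y" if "u < r" for u
    using e[OF that] T(1) by auto
  show ?thesis
  proof (rule restricts_select[where a = "a \<circ> e" and b = "b \<circ> e" and c = "c \<circ> e"])
    fix u v w
    assume "u < dim1 (unit_tensor r :: 'a tensor3)" "v < dim2 (unit_tensor r :: 'a tensor3)" "w < dim3 (unit_tensor r :: 'a tensor3)"
    then have uvw: "u < r" "v < r" "w < r" by simp_all
    show "coord (unit_tensor r) u v w = coord s ((a \<circ> e) u) ((b \<circ> e) v) ((c \<circ> e) w)"
    proof (cases "u = v \<and> v = w")
      case True
      then show ?thesis using uvw 1[OF em[OF uvw(1)]] by (simp add: coord_unit_tensor)
    next
      case False
      then have ne: "\<not> (e u = e v \<and> e v = e w)"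
        using inj uvw by (auto simp: inj_on_def)
      \<comment> \<open>Since \<open>f\<close> and \<open>g\<close> are constant on
        \<open>T\<close>, the mixed weight equals that of the diagonal triple at
        \<open>e w\<close>.\<close>
      have "f (e u) + g (e v) + h (e w) = 0"
        using 1[OF em[OF uvw(3)]] fe uvw ge by simp
      then have "coord s (a (e u)) (b (e v)) (c (e w)) = 0"
        using 2[OF em em em, OF uvw] ne by force
      with False show ?thesis by (auto simp: coord_unit_tensor)
    qed
  qed (use 1 em in auto)
qed

text \<open>
  Strassen's degeneration: keep the triples with \<open>i + j + k = n - 1\<close>. With \<open>k' = k - (n - 1)\<close>, the total
  weight \<open>(i + j + k')^2\<close> is the sum of \<open>i^2 + 2 i j\<close>, \<open>j^2 + 2 j k'\<close> and \<open>k'^2 + 2 k' i\<close>. For \<open>n = 2 h\<close> and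
  \<open>i, j < h\<close> there is always such a \<open>k < n\<close>, which gives \<open>h^2\<close> triples.
\<close>

lemma contains_matmul_degeneration:
  assumes "contains_matmul s L (2 * h)" "h > 0"
  shows "\<exists>B. combinatorial_degeneration s (L * (h * h)) B"
proof -
  obtain a b c where *:
    "\<And>l i j. l < L \<Longrightarrow> i < 2 * h \<Longrightarrow> j < 2 * h \<Longrightarrow> a l i j < dim1 s"
    "\<And>l j k. l < L \<Longrightarrow> j < 2 * h \<Longrightarrow> k < 2 * h \<Longrightarrow> b l j k < dim2 s"
    "\<And>l k i. l < L \<Longrightarrow> k < 2 * h \<Longrightarrow> i < 2 * h \<Longrightarrow> c l k i < dim3 s"
    "\<And>l l' l'' i i' j j' k k'. l < L \<Longrightarrow> l' < L \<Longrightarrow> l'' < L \<Longrightarrow> i < 2 * h \<Longrightarrow> i' < 2 * h \<Longrightarrow> j < 2 * h \<Longrightarrow>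
      j' < 2 * h \<Longrightarrow> k < 2 * h \<Longrightarrow> k' < 2 * h \<Longrightarrow> coord s (a l i j) (b l' j' k) (c l'' k' i') =
       (if l = l' \<and> l' = l'' \<and> i = i' \<and> j = j' \<and> k = k' then 1 else 0)"
    using assms(1) by (elim contains_matmulE) (rule that)
  \<comment> \<open>A label \<open>u\<close> encodes a summand \<open>l\<close> together with a pair
    \<open>i, j < h\<close>.\<close>
  define l where "l u = u div (h * h)" for u
  define i where "i u = u mod (h * h) div h" for u
  define j where "j u = u mod (h * h) mod h" for u
  \<comment> \<open>For labels in range the truncated subtraction is exact, as
    \<open>i + j \<le> 2 * h - 2\<close>.\<close>
  define k where "k u = 2 * h - 1 - (i u + j u)" for u
  have lij: "l u < L" "i u < h" "j u < h" if "u < L * (h * h)" for u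
    using less_mult_div_mod[OF that] less_mult_div_mod[of "u mod (h * h)" h h] assms(2)
    by (simp_all add: l_def i_def j_def)
  have b: "l u < L" "i u < 2 * h" "j u < 2 * h" "k u < 2 * h" if "u < L * (h * h)" for u
    using lij[OF that] assms(2) by (simp_all add: k_def)
  have k: "int (k u) = 2 * int h - 1 - (int (i u) + int (j u))" if "u < L * (h * h)" for u
    using lij[OF that] by (simp add: k_def of_nat_diff)
  have inj: "u = v" if "l u = l v" "i u = i v" "j u = j v" for u v
    using that unfolding l_def i_def j_def by (metis div_mult_mod_eq)
  \<comment> \<open>The three weights, with k' replaced by \<open>- (i u + j u)\<close>;
    \<open>e\<close> belongs to the third factor.\<close>
  define f where "f u = int (i u) ^ 2 + 2 * int (i u) * int (j u)" for u
  define g where "g u = int (j u) ^ 2 - 2 * int (j u) * (int (i u) + int (j u))" for u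
  define e where "e u = (int (i u) + int (j u)) ^ 2 - 2 * (int (i u) + int (j u)) * int (i u)" for u
  define B where "B = (\<Sum>u<L * (h * h). nat \<bar>f u\<bar> + nat \<bar>g u\<bar>)"
  have B: "\<bar>f u\<bar> \<le> int B \<and> \<bar>g u\<bar> \<le> int B" if "u < L * (h * h)" for u
  proof -
    have "nat \<bar>f u\<bar> + nat \<bar>g u\<bar> \<le> B"
      unfolding B_def using that by (intro member_le_sum) auto
    then show ?thesis by linarith
  qed
  have pos: "f u + g v + e w > 0"
    if bd: "u < L * (h * h)" "v < L * (h * h)" "w < L * (h * h)"
      and nz: "coord s (a (l u) (i u) (j u)) (b (l v) (j v) (k v)) (c (l w) (k w) (i w)) \<noteq> 0"
      and ne: "\<not> (u = v \<and> v = w)" for u v w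
  proof -
    \<comment> \<open>A nonzero entry forces shared indices to agree; agreement of
      \<open>k v\<close> and \<open>k w\<close> then says that the sums \<open>i + j\<close>
      agree.\<close>
    have eqs: "l u = l v" "l v = l w" "i u = i w" "j u = j v" "k v = k w"
      using nz b[OF bd(1)] b[OF bd(2)] b[OF bd(3)] by (simp_all add: *(4) split: if_splits)
    have s: "int (i v) + int (j v) = int (i w) + int (j w)"
      using k[OF bd(2)] k[OF bd(3)] eqs(5) by simp
    define x where "x = int (i w) + int (j w)"
    have "f u = int (i w) ^ 2 + 2 * int (i w) * int (j v)" "g v = int (j v) ^ 2 - 2 * int (j v) * x"
      "e w = x ^ 2 - 2 * x * int (i w)"
      by (simp_all only: f_def g_def e_def x_def eqs(3,4) s)
    then have "f u + g v + e w = (int (i u) + int (j u) - x) ^ 2"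
      unfolding eqs(3,4) by (simp add: power2_eq_square algebra_simps)
    \<comment> \<open>If the square vanished, all three labels would agree in \<open>l\<close>,
      \<open>i\<close> and \<open>j\<close>.\<close>
    moreover have "int (i u) + int (j u) - x \<noteq> 0"
    proof
      assume "int (i u) + int (j u) - x = 0"
      then have "i u = i v" "j v = j w"
        using s eqs unfolding x_def by simp_all
      with eqs ne show False
        using inj[of u v] inj[of v w] by simp
    qed
    ultimately show ?thesis by simp
  qed
  have diag: "a (l u) (i u) (j u) < dim1 s \<and> b (l u) (j u) (k u) < dim2 s \<and> c (l u) (k u) (i u) < dim3 s \<and>
      coord s (a (l u) (i u) (j u)) (b (l u) (j u) (k u)) (c (l u) (k u) (i u)) = 1 \<and>
      f u + g u + e u = 0 \<and> \<bar>f u\<bar> \<le> int B \<and> \<bar>g u\<bar> \<le> int B"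
    if u: "u < L * (h * h)" for u
  proof -
    have "f u + g u + e u = 0"
      by (simp add: f_def g_def e_def power2_eq_square algebra_simps)
    then show ?thesis
      using b[OF u] B[OF u] by (simp add: *)
  qed
  have "combinatorial_degeneration s (L * (h * h)) B"
    unfolding combinatorial_degeneration_def
    by (rule exI[of _ "\<lambda>u. a (l u) (i u) (j u)"], rule exI[of _ "\<lambda>u. b (l u) (j u) (k u)"],
        rule exI[of _ "\<lambda>u. c (l u) (k u) (i u)"], rule exI[of _ f], rule exI[of _ g], rule exI[of _ e],
        rule conjI)
      (intro allI impI, rule diag, assumption, intro allI impI, rule pos, assumption+)
  then show ?thesis by blast
qed

section \<open>The barrier\<close>

text \<open>For \<open>c = a + 4\<close> one has \<open>a * c + 1 \<le> c ^ 2 \<le> 2 ^ c\<close>,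
  the second inequality because \<open>c \<ge> 4\<close>.\<close>

lemma exists_linear_le_power2: "\<exists>c\<ge>1. a * c + 1 \<le> (2 :: nat) ^ c"
proof (intro exI[of _ "a + 4"] conjI)
  have "n ^ 2 \<le> (2 :: nat) ^ n" if "n \<ge> 4" for n
    using that
  proof (induction n rule: dec_induct)
    case (step n)
    have "4 * n \<le> n * n" using step by (intro mult_right_mono) auto
    then have "Suc (n + n) \<le> n * n" using step(1) by linarith
    then have "Suc n ^ 2 \<le> 2 * n ^ 2"
      by (simp add: power2_eq_square)
    with step show ?case by simp
  qed simp
  from this[of "a + 4"] have "(a + 4) ^ 2 \<le> (2 :: nat) ^ (a + 4)" by simp
  then show "a * (a + 4) + 1 \<le> (2 :: nat) ^ (a + 4)"
    by (simp add: power2_eq_square algebra_simps)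
qed simp

text \<open>Strassen's degeneration provides a diagonal of size \<open>2 ^ (l + 2 * m)\<close> per
  copy of \<open>s\<close>. Giving up one factor 2 per copy pays for the pigeonhole loss once there
  are enough copies.\<close>

lemma contains_matmul_power_restricts_unit:
  assumes "contains_matmul s (2 ^ l) (2 ^ Suc m)" "l + 2 * m \<ge> 1"
  shows "\<exists>N\<ge>1. restricts (kron_power s N) (unit_tensor (2 ^ ((l + 2 * m - 1) * N)))"
proof -
  define e where "e = l + 2 * m"
  have "\<exists>B. combinatorial_degeneration s (2 ^ l * (2 ^ m * 2 ^ m)) B"
    using assms(1) by (intro contains_matmul_degeneration) simp_all
  moreover have "2 ^ l * (2 ^ m * 2 ^ m) = (2 :: nat) ^ e"
    unfolding e_def by (simp add: power_add mult_2)
  ultimately obtain B where B: "combinatorial_degeneration s (2 ^ e) B"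
    by auto
  obtain c where c: "c \<ge> 1" "4 * B * c + 1 \<le> (2 :: nat) ^ c"
    using exists_linear_le_power2 by blast
  \<comment> \<open>With \<open>N = 2 * c\<close> copies the loss is
    \<open>(4 * B * c + 1) ^ 2\<close>, which is at most \<open>2 ^ N\<close> by the choice of
    \<open>c\<close>.\<close>
  have "combinatorial_degeneration (kron_power s (2 * c)) ((2 ^ e) ^ (2 * c)) (2 * c * B)"
    using B by (rule combinatorial_degeneration_kron_power)
  moreover have "2 ^ ((e - 1) * (2 * c)) * (2 * (2 * c * B) + 1) ^ 2 \<le> ((2 :: nat) ^ e) ^ (2 * c)"
  proof -
    have "(2 * (2 * c * B) + 1) ^ 2 \<le> ((2 :: nat) ^ c) ^ 2"
      using c(2) by (intro power_mono) (simp_all add: mult_ac)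
    then have "2 ^ ((e - 1) * (2 * c)) * (2 * (2 * c * B) + 1) ^ 2 \<le> 2 ^ ((e - 1) * (2 * c)) * ((2 :: nat) ^ c) ^ 2"
      by simp
    also have "\<dots> = 2 ^ ((e - 1) * (2 * c) + c * 2)"
      by (simp only: power_add power_mult)
    also have "(e - 1) * (2 * c) + c * 2 = e * (2 * c)"
      using assms(2) by (cases e) (simp_all add: e_def)
    finally show ?thesis by (simp only: power_mult)
  qed
  ultimately have "restricts (kron_power s (2 * c)) (unit_tensor (2 ^ ((e - 1) * (2 * c))))"
    by (rule combinatorial_degeneration_restricts)
  with c(1) show ?thesis
    unfolding e_def by (intro exI[of _ "2 * c"]) simp
qed

text \<open>On the \<open>q\<close>-th power of \<open>s\<close> the exponent \<open>d * q\<close>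
  drops by only 3: by 2 for halving the matrix size and by 1 for the pigeonhole loss. Dividing by
  \<open>q\<close> removes this in the limit.\<close>

lemma rel_exponent_matmul_ge:
  fixes t :: "'a :: field tensor3" and \<alpha> \<beta> :: nat
  defines "s \<equiv> kron3 (kron_power (unit_tensor 2) \<alpha>) (kron_power (matmul_tensor 2 2 2) \<beta>)"
  assumes "\<beta> \<ge> 1"
  shows "ereal (real (\<alpha> + 2 * \<beta>)) * rel_exponent t (unit_tensor 2) \<le> rel_exponent t s"
proof -
  define d where "d = \<alpha> + 2 * \<beta>"
  define y where "y = rel_exponent t (unit_tensor 2)"
  define z where "z = rel_exponent t s"
  have s: "contains_matmul s (2 ^ \<alpha>) (2 ^ \<beta>)"
    using contains_matmul_kron3[OF contains_matmul_kron_power[OF contains_matmul_unit[of 2]]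
        contains_matmul_kron_power[OF contains_matmul_matmul[of 2]]]
    unfolding s_def by simp
  have "nonzero_tensor (matmul_tensor 2 2 2 :: 'a tensor3)"
    using contains_matmul_matmul[of 2] unfolding contains_matmul_def nonzero_tensor_def
    by (metis less_numeral_extra(1) zero_neq_one pos2)
  then have s_nz: "nonzero_tensor s"
    unfolding s_def by (intro nonzero_tensor_kron3 nonzero_tensor_kron_power nonzero_tensor_unit) auto
  have y0: "y \<ge> 0" and z0: "z \<ge> 0"
    unfolding y_def z_def using s_nz by (simp_all add: rel_exponent_nonneg nonzero_tensor_unit)
  have step: "ereal (real (d * q - 3)) * y \<le> ereal (real q) * z" if q: "q \<ge> 2" for q
  proof -
    \<comment> \<open>The matrix size \<open>2 ^ (\<beta> * q)\<close> is to be \<open>2 * h\<close>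
      with \<open>h = 2 ^ m\<close>.\<close>
    define m where "m = \<beta> * q - 1"
    have m: "\<beta> * q = Suc m" "\<alpha> * q + 2 * m = d * q - 2" "d * q \<ge> 4"
    proof -
      have "1 * 2 \<le> \<beta> * q" using assms(2) q by (intro mult_le_mono)
      then show "\<beta> * q = Suc m" "\<alpha> * q + 2 * m = d * q - 2" "d * q \<ge> 4"
        by (simp_all add: m_def d_def algebra_simps)
    qed
    have "contains_matmul (kron_power s q) ((2 ^ \<alpha>) ^ q) ((2 ^ \<beta>) ^ q)"
      using s by (rule contains_matmul_kron_power)
    then have "contains_matmul (kron_power s q) (2 ^ (\<alpha> * q)) (2 ^ Suc m)"
      by (simp only: power_mult[symmetric] m)
    moreover have "\<alpha> * q + 2 * m \<ge> 1" using m by linarith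
    ultimately obtain N where N: "N \<ge> 1"
      "restricts (kron_power (kron_power s q) N) (unit_tensor (2 ^ ((\<alpha> * q + 2 * m - 1) * N)))"
      using contains_matmul_power_restricts_unit by blast
    have "restricts (kron_power s (q * N)) (kron_power (unit_tensor 2) ((d * q - 3) * N))"
      using N(2) m by (simp add: kron_power_mult kron_power_unit power_mult)
    then have "ereal (real ((d * q - 3) * N)) * y \<le> ereal (real (q * N)) * z"
      unfolding y_def z_def using q N by (intro rel_exponent_restricts s_nz nonzero_tensor_unit) auto
    then have "ereal (real N) * (ereal (real (d * q - 3)) * y) \<le> ereal (real N) * (ereal (real q) * z)"
      by (simp add: mult.assoc[symmetric] mult.commute[of "real N"])
    then show ?thesis
      using N(1) by (subst (asm) ereal_mult_le_mult_iff) simp_all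
  qed
  \<comment> \<open>The coefficient of \<open>y\<close> at \<open>q = 2\<close> is positive, so an
    infinite \<open>y\<close> forces an infinite \<open>z\<close>.\<close>
  have "d * 2 - 3 > 0"
    using assms(2) by (simp add: d_def)
  have "ereal (real d) * y \<le> z"
  proof (cases y)
    case PInf
    then have "z = \<infinity>"
      using step[of 2] \<open>d * 2 - 3 > 0\<close> by (cases z) auto
    then show ?thesis by simp
  next
    case (real y')
    show ?thesis
    proof (cases z)
      case (real z')
      \<comment> \<open>This is \<open>step\<close> at \<open>q = n + 2\<close>, divided by
        \<open>q\<close>; the error \<open>3 * y' / q\<close> is weakened to a standard null
        sequence.\<close>
      have "real d * y' - z' \<le> inverse (real (Suc n)) * (3 * y')" for n
      proof -
        have "d * (n + 2) \<ge> 3"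
          using assms(2) by (simp add: d_def algebra_simps)
        then have "(real d * real (n + 2) - 3) * y' \<le> real (n + 2) * z'"
          using step[of "n + 2"] real \<open>y = ereal y'\<close> by (simp add: of_nat_diff algebra_simps)
        then have "real d * y' - z' \<le> 3 * y' / real (n + 2)"
          by (simp add: field_simps)
        also have "\<dots> \<le> 3 * y' / real (Suc n)"
          using y0 \<open>y = ereal y'\<close> by (intro divide_left_mono) auto
        finally show ?thesis by (simp add: field_simps)
      qed
      moreover have "(\<lambda>n. inverse (real (Suc n)) * (3 * y')) \<longlonglongrightarrow> 0 * (3 * y')"
        by (intro tendsto_mult LIMSEQ_inverse_real_of_nat tendsto_const)
      ultimately have "real d * y' - z' \<le> 0 * (3 * y')"
        by (intro LIMSEQ_le_const) auto
      then show ?thesis using real \<open>y = ereal y'\<close> by simp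
    qed (use z0 in auto)
  qed (use y0 in auto)
  then show ?thesis
    by (simp add: d_def y_def z_def)
qed

theorem theorem3p2:
  fixes t :: "'a :: field tensor3" and \<alpha> \<beta> :: nat
  assumes "\<not> simple_tensor t" and "\<beta> \<ge> 1"
  shows "(rel_exponent (unit_tensor 2) t *
            rel_exponent t (kron3 (kron_power (unit_tensor 2) \<alpha>)
                                  (kron_power (matmul_tensor 2 2 2) \<beta>))
            - ereal (real \<alpha>)) / ereal (real \<beta>)
         \<ge> 2 * irreversibility t + ereal (real \<alpha> / real \<beta>) * (irreversibility t - 1)
       \<and> 2 * irreversibility t + ereal (real \<alpha> / real \<beta>) * (irreversibility t - 1)
         \<ge> 2 * irreversibility t"
proof -
  define z where "z = rel_exponent t (kron3 (kron_power (unit_tensor 2) \<alpha>) (kron_power (matmul_tensor 2 2 2) \<beta>))"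
  define x where "x = rel_exponent (unit_tensor 2) t"
  define w where "w = x * z"
  define r where "r = irreversibility t"
  have "x \<ge> 0"
    unfolding x_def using assms(1) by (intro rel_exponent_nonneg not_simple_nonzero)
  have r1: "r \<ge> 1"
    unfolding r_def using assms(1) by (rule irreversibility_ge_1)
  \<comment> \<open>Multiplication by \<open>x\<close> turns \<omega>(t, \<langle>2\<rangle>) into
    the irreversibility.\<close>
  have "x * (ereal (real (\<alpha> + 2 * \<beta>)) * rel_exponent t (unit_tensor 2)) \<le> x * z"
    unfolding z_def using rel_exponent_matmul_ge[OF assms(2)] \<open>x \<ge> 0\<close> by (rule ereal_mult_left_mono)
  then have le: "ereal (real (\<alpha> + 2 * \<beta>)) * r \<le> w"
    unfolding w_def r_def irreversibility_def x_def by (metis mult.left_commute)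
  have \<beta>: "real \<beta> > 0" using assms(2) by simp
  have "2 * r + ereal (real \<alpha> / real \<beta>) * (r - 1) \<le> (w - ereal (real \<alpha>)) / ereal (real \<beta>)
      \<and> 2 * r \<le> 2 * r + ereal (real \<alpha> / real \<beta>) * (r - 1)"
  \<comment> \<open>The irreversibility may be infinite. Then \<open>w\<close> is infinite as well,
    because \<open>\<alpha> + 2 * \<beta>\<close> is positive, and all expressions compared equal
    \<infinity>.\<close>
  proof (cases r)
    case (real r')
    with r1 have r': "r' \<ge> 1" by (simp add: one_ereal_def)
    have eq: "2 * r + ereal (real \<alpha> / real \<beta>) * (r - 1) =
        ereal (2 * r' + real \<alpha> / real \<beta> * (r' - 1))"
      by (simp add: real one_ereal_def numeral_eq_ereal)
    have "2 * r = ereal (2 * r')"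
      by (simp add: real)
    moreover have "2 * r' \<le> 2 * r' + real \<alpha> / real \<beta> * (r' - 1)"
      using r' by simp
    moreover have "ereal (2 * r' + real \<alpha> / real \<beta> * (r' - 1)) \<le> (w - ereal (real \<alpha>)) / ereal (real \<beta>)"
    proof (cases "w")
      case (real w')
      have "(real \<alpha> + 2 * real \<beta>) * r' \<le> w'"
        using le real \<open>r = ereal r'\<close> by simp
      then have "((real \<alpha> + 2 * real \<beta>) * r' - real \<alpha>) / real \<beta> \<le> (w' - real \<alpha>) / real \<beta>"
        using \<beta> by (intro divide_right_mono) auto
      moreover have "2 * r' + real \<alpha> / real \<beta> * (r' - 1) = ((real \<alpha> + 2 * real \<beta>) * r' - real \<alpha>) / real \<beta>"
        using \<beta> by (simp add: field_simps)
      ultimately have "2 * r' + real \<alpha> / real \<beta> * (r' - 1) \<le> (w' - real \<alpha>) / real \<beta>"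
        by simp
      then show ?thesis using real \<beta> by simp
    qed (use le real \<beta> in auto)
    ultimately show ?thesis unfolding eq by simp
  next
    case PInf
    then have "w = \<infinity>"
      using le assms(2) by (cases "w") auto
    then show ?thesis using PInf \<beta> by simp
  qed (use r1 in simp)
  then show ?thesis
    by (simp add: w_def z_def x_def r_def)
qed

end
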